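(* Let $\mathcal{G}=(G,\gamma,\lambda)$ be a temporal digraph with temporal vertex set $V_T$, and let $R_1,\dots,R_k\subseteq V_T$. If for every $v\in V(G)$ the set $\gamma(v)$ is exactly one interval of consecutive integers, then deciding whether $\mathcal{G}$ has $k$ pairwise edge-disjoint temporal-spanning branchings rooted at $R_1,\dots,R_k$ respectively, and finding them if they exist, can be done in polynomial time.
   Context: A temporal digraph is a triple $\mathcal{G}=(G,\gamma,\lambda)$ where $G$ is a finite digraph, $\gamma(v)\subseteq\mathbb{N}$ for each $v\in V(G)$, and $\lambda(e)\subseteq\mathbb{N}\times\mathbb{N}$ for each $e\in E(G)$, such that if $(t,t')\in\lambda(uv)$ then $t\le t'$, $t\in\gamma(u)$, $t'\in\gamma(v)$. Temporal vertices: $V_T=\{(v,t):t\in\gamma(v)\}$; temporal edges: $(u,t)(v,t')$ for $uv\in E(G)$, $(t,t')\in\lambda(uv)$. A temporal walk is a sequence of temporal vertices and temporal edges in which each temporal edge goes from the preceding to the following temporal vertex, and any two consecutive temporal vertices are $(v,t),(v,t+1)$. A temporal subdigraph is $(G',\gamma',\lambda')$ with $G'\subseteq G,\gamma'\subseteq\gamma,\lambda'\subseteq\lambda$. For $R\subseteq V_T$, a temporal subdigraph $\mathcal{B}$ is a temporal-spanning branching with root $R$ if every $(u,i)\in V_T$ is the end of exactly one temporal walk in $\mathcal{B}$ starting at a vertex of $R$. Branchings $(G_1,\gamma_1,\lambda_1),(G_2,\gamma_2,\lambda_2)$ are edge-disjoint if $E(G_1)\cap E(G_2)=\emptyset$.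 *)

theory Defs
  imports "HOL-Computational_Algebra.Polynomial"
begin

section \<open>Temporal digraphs\<close>

record 'v tdigraph =
  verts :: "'v set"
  edges :: "('v \<times> 'v) set"
  active :: "'v \<Rightarrow> nat set"
  labels :: "'v \<times> 'v \<Rightarrow> (nat \<times> nat) set"

definition temporal_digraph :: "'v tdigraph \<Rightarrow> bool" where
  "temporal_digraph G \<longleftrightarrow>
     finite (verts G) \<and> edges G \<subseteq> verts G \<times> verts G \<and>
     (\<forall>u v t t'. (u, v) \<in> edges G \<longrightarrow> (t, t') \<in> labels G (u, v) \<longrightarrow>
        t \<le> t' \<and> t \<in> active G u \<and> t' \<in> active G v)"

definition tverts :: "'v tdigraph \<Rightarrow> ('v \<times> nat) set" where
  "tverts G = {(v, t). v \<in> verts G \<and> t \<in> active G v}"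

definition tedges :: "'v tdigraph \<Rightarrow> (('v \<times> nat) \<times> ('v \<times> nat)) set" where
  "tedges G = {((u, t), (v, t')) | u t v t'. (u, v) \<in> edges G \<and> (t, t') \<in> labels G (u, v)}"

text \<open>
  Walks record the temporal edges they use, so that waiting from \<open>(v, t)\<close> to \<open>(v, t + 1)\<close> and
  traversing a loop with label \<open>(t, t + 1)\<close> at \<open>v\<close> give different walks. A single temporal vertex
  is a walk.
\<close>

datatype 'v titem = TVertex "'v \<times> nat" | TEdge "'v \<times> nat" "'v \<times> nat"

inductive twalk :: "'v tdigraph \<Rightarrow> 'v titem list \<Rightarrow> bool" for G where
  single: "x \<in> tverts G \<Longrightarrow> twalk G [TVertex x]"
| wait: "(v, t) \<in> tverts G \<Longrightarrow> twalk G (TVertex (v, t + 1) # w) \<Longrightarrow>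
    twalk G (TVertex (v, t) # TVertex (v, t + 1) # w)"
| edge: "x \<in> tverts G \<Longrightarrow> (x, y) \<in> tedges G \<Longrightarrow> twalk G (TVertex y # w) \<Longrightarrow>
    twalk G (TVertex x # TEdge x y # TVertex y # w)"

definition temporal_subdigraph :: "'v tdigraph \<Rightarrow> 'v tdigraph \<Rightarrow> bool" where
  "temporal_subdigraph B G \<longleftrightarrow>
     temporal_digraph B \<and> verts B \<subseteq> verts G \<and> edges B \<subseteq> edges G \<and>
     (\<forall>v\<in>verts B. active B v \<subseteq> active G v) \<and>
     (\<forall>e\<in>edges B. labels B e \<subseteq> labels G e)"

definition temporal_spanning_branching ::
    "'v tdigraph \<Rightarrow> ('v \<times> nat) set \<Rightarrow> 'v tdigraph \<Rightarrow> bool" where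
  "temporal_spanning_branching G R B \<longleftrightarrow>
     temporal_subdigraph B G \<and>
     (\<forall>x\<in>tverts G. \<exists>!w. twalk B w \<and> hd w \<in> TVertex ` R \<and> last w = TVertex x)"

definition edge_disjoint :: "'v tdigraph \<Rightarrow> 'v tdigraph \<Rightarrow> bool" where
  "edge_disjoint B B' \<longleftrightarrow> edges B \<inter> edges B' = {}"

definition disjoint_spanning_branchings ::
    "'v tdigraph \<Rightarrow> ('v \<times> nat) set list \<Rightarrow> 'v tdigraph list \<Rightarrow> bool" where
  "disjoint_spanning_branchings G Rs Bs \<longleftrightarrow>
     length Bs = length Rs \<and>
     (\<forall>i<length Rs. temporal_spanning_branching G (Rs ! i) (Bs ! i)) \<and>
     (\<forall>i<length Rs. \<forall>j<length Rs. i \<noteq> j \<longrightarrow> edge_disjoint (Bs ! i) (Bs ! j))"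


section \<open>Polynomial time\<close>

text \<open>
  The machine model is the language of while programs over binary trees (N. D. Jones,
  \<^emph>\<open>Computability and Complexity from a Programming Perspective\<close>). In contrast to the usual unit
  cost, an assignment is charged the number of nodes of the value it stores. Hence no stored
  tree exceeds the running time plus the input size (sharing is paid for), and polynomial time here
  coincides with polynomial time on Turing machines, for functions as well as for decision
  problems.
\<close>

datatype btree = Leaf | Node btree btree

fun nodes :: "btree \<Rightarrow> nat" where
  "nodes Leaf = 1"
| "nodes (Node l r) = 1 + nodes l + nodes r"

fun left :: "btree \<Rightarrow> btree" where
  "left Leaf = Leaf"
| "left (Node l r) = l"

fun right :: "btree \<Rightarrow> btree" where
  "right Leaf = Leaf"
| "right (Node l r) = r"

type_synonym store = "nat \<Rightarrow> btree"

datatype expr = Var nat | ELeaf | ENode expr expr | ELeft expr | ERight expr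

fun val :: "expr \<Rightarrow> store \<Rightarrow> btree" where
  "val (Var x) s = s x"
| "val ELeaf s = Leaf"
| "val (ENode a b) s = Node (val a s) (val b s)"
| "val (ELeft a) s = left (val a s)"
| "val (ERight a) s = right (val a s)"

datatype prog =
    Skip
  | Assign nat expr
  | Seq prog prog
  | If expr prog prog
  | While expr prog

text \<open>\<open>exec c s n s'\<close>: from store \<open>s\<close>, the program \<open>c\<close> terminates in store \<open>s'\<close> at cost \<open>n\<close>.
  A test succeeds iff its value is not \<open>Leaf\<close>.\<close>

inductive exec :: "prog \<Rightarrow> store \<Rightarrow> nat \<Rightarrow> store \<Rightarrow> bool" where
  Skip: "exec Skip s 1 s"
| Assign: "exec (Assign x a) s (1 + nodes (val a s)) (s(x := val a s))"
| Seq: "exec c1 s m s' \<Longrightarrow> exec c2 s' n s'' \<Longrightarrow> exec (Seq c1 c2) s (m + n) s''"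
| IfTrue: "val b s \<noteq> Leaf \<Longrightarrow> exec c1 s n s' \<Longrightarrow> exec (If b c1 c2) s (1 + n) s'"
| IfFalse: "val b s = Leaf \<Longrightarrow> exec c2 s n s' \<Longrightarrow> exec (If b c1 c2) s (1 + n) s'"
| WhileFalse: "val b s = Leaf \<Longrightarrow> exec (While b c) s 1 s"
| WhileTrue: "val b s \<noteq> Leaf \<Longrightarrow> exec c s m s' \<Longrightarrow> exec (While b c) s' n s'' \<Longrightarrow>
    exec (While b c) s (1 + m + n) s''"

inductive_cases SkipE: "exec Skip s n s'"
inductive_cases AssignE: "exec (Assign x a) s n s'"
inductive_cases SeqE: "exec (Seq c1 c2) s n s'"
inductive_cases IfE: "exec (If b c1 c2) s n s'"
inductive_cases WhileE: "exec (While b c) s n s'"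

lemma exec_deterministic:
  "exec c s n s' \<Longrightarrow> exec c s m s'' \<Longrightarrow> m = n \<and> s'' = s'"
proof (induction arbitrary: m s'' rule: exec.induct)
  case (Skip s)
  then show ?case by (auto elim: SkipE)
next
  case (Assign x a s)
  then show ?case by (auto elim: AssignE)
next
  case (Seq c1 s k s1 c2 n s2)
  from Seq.prems obtain k' s1' n' where "m = k' + n'" "exec c1 s k' s1'" "exec c2 s1' n' s''"
    by (rule SeqE)
  with Seq.IH show ?case by metis
next
  case (IfTrue b s c1 n s1 c2)
  from IfTrue.prems IfTrue.hyps(1) obtain n' where "m = 1 + n'" "exec c1 s n' s''"
    by (elim IfE) simp_all
  with IfTrue.IH show ?case by metis
next
  case (IfFalse b s c2 n s1 c1)
  from IfFalse.prems IfFalse.hyps(1) obtain n' where "m = 1 + n'" "exec c2 s n' s''"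
    by (elim IfE) simp_all
  with IfFalse.IH show ?case by metis
next
  case (WhileFalse b s c)
  from WhileFalse.prems show ?case by (rule WhileE) (simp_all add: WhileFalse.hyps)
next
  case (WhileTrue b s c k s1 n s2)
  from WhileTrue.prems obtain k' s1' n'
    where "m = 1 + k' + n'" "exec c s k' s1'" "exec (While b c) s1' n' s''"
    by (rule WhileE) (simp_all add: WhileTrue.hyps(1))
  with WhileTrue.IH show ?case by metis
qed

text \<open>
  Promise search problems: one program, with one polynomial bounding its cost in terms of the size
  of the encoded input, must produce on every \<open>x\<close> satisfying the promise \<open>P\<close> the encoding of some
  \<open>y\<close> with \<open>Q x y\<close>. Input and output are in variable \<open>0\<close>.
\<close>

definition solvable_in_polynomial_time ::
    "('a \<Rightarrow> btree) \<Rightarrow> ('b \<Rightarrow> btree) \<Rightarrow> ('a \<Rightarrow> bool) \<Rightarrow> ('a \<Rightarrow> 'b \<Rightarrow> bool) \<Rightarrow> bool" where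
  "solvable_in_polynomial_time enc_in enc_out P Q \<longleftrightarrow>
     (\<exists>(c :: prog) (p :: nat poly). \<forall>x. P x \<longrightarrow>
        (\<exists>n s y. exec c ((\<lambda>_. Leaf)(0 := enc_in x)) n s \<and>
           n \<le> poly p (nodes (enc_in x)) \<and> s 0 = enc_out y \<and> Q x y))"


section \<open>Encodings\<close>

fun enc_bool :: "bool \<Rightarrow> btree" where
  "enc_bool False = Leaf"
| "enc_bool True = Node Leaf Leaf"

text \<open>Binary numerals, least significant bit first.\<close>

fun enc_nat :: "nat \<Rightarrow> btree" where
  "enc_nat n = (if n = 0 then Leaf else Node (enc_bool (odd n)) (enc_nat (n div 2)))"

declare enc_nat.simps [simp del]

fun enc_pair :: "('a \<Rightarrow> btree) \<Rightarrow> ('b \<Rightarrow> btree) \<Rightarrow> 'a \<times> 'b \<Rightarrow> btree" where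
  "enc_pair f g (a, b) = Node (f a) (g b)"

fun enc_list :: "('a \<Rightarrow> btree) \<Rightarrow> 'a list \<Rightarrow> btree" where
  "enc_list f [] = Leaf"
| "enc_list f (x # xs) = Node (f x) (enc_list f xs)"

fun enc_option :: "('a \<Rightarrow> btree) \<Rightarrow> 'a option \<Rightarrow> btree" where
  "enc_option f None = Leaf"
| "enc_option f (Some x) = Node (f x) Leaf"

lemma inj_enc_nat: "inj enc_nat"
proof (rule injI)
  show "m = n" if "enc_nat m = enc_nat n" for m n
    using that
  proof (induction m arbitrary: n rule: less_induct)
    case (less m)
    show ?case
    proof (cases "m = 0 \<or> n = 0")
      case True
      with less.prems show ?thesis
        by (auto simp: enc_nat.simps[of m] enc_nat.simps[of n] split: if_splits)
    next
      case False
      with less.prems have "enc_bool (odd m) = enc_bool (odd n)"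
        and "enc_nat (m div 2) = enc_nat (n div 2)"
        by (auto simp: enc_nat.simps[of m] enc_nat.simps[of n])
      moreover from this(2) have "m div 2 = n div 2"
        using False by (intro less.IH) auto
      moreover have "odd m = odd n"
        using calculation(1) by (cases "odd m"; cases "odd n") auto
      ultimately show ?thesis
        by (metis even_two_times_div_two odd_two_times_div_two_succ)
    qed
  qed
qed

lemma inj_enc_pair: "inj f \<Longrightarrow> inj g \<Longrightarrow> inj (enc_pair f g)"
  by (auto simp: inj_def)

lemma inj_enc_list:
  assumes "inj f"
  shows "inj (enc_list f)"
proof (rule injI)
  show "xs = ys" if "enc_list f xs = enc_list f ys" for xs ys
    using that
  proof (induction xs arbitrary: ys)
    case Nil
    then show ?case by (cases ys) auto
  next
    case (Cons x xs)
    then show ?case using assms by (cases ys) (auto dest: injD)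
  qed
qed

lemma inj_enc_option:
  assumes "inj f"
  shows "inj (enc_option f)"
proof (rule injI)
  show "a = b" if "enc_option f a = enc_option f b" for a b
    using that assms by (cases a; cases b) (auto dest: injD)
qed

text \<open>
  Finite temporal digraphs on natural numbers are presented by listing each vertex with its active
  times and each edge with its labels. Neither the order of the entries nor repetitions matter: the
  entries of a repeated vertex or edge are united.
\<close>

type_synonym tdigraph_rep =
  "(nat \<times> nat list) list \<times> ((nat \<times> nat) \<times> (nat \<times> nat) list) list"

definition tdigraph_of :: "tdigraph_rep \<Rightarrow> nat tdigraph" where
  "tdigraph_of g =
     \<lparr>verts = fst ` set (fst g),
      edges = fst ` set (snd g),
      active = (\<lambda>v. \<Union> {set ts | ts. (v, ts) \<in> set (fst g)}),
      labels = (\<lambda>e. \<Union> {set ls | ls. (e, ls) \<in> set (snd g)})\<rparr>"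

definition enc_tdigraph :: "tdigraph_rep \<Rightarrow> btree" where
  "enc_tdigraph =
     enc_pair
       (enc_list (enc_pair enc_nat (enc_list enc_nat)))
       (enc_list (enc_pair (enc_pair enc_nat enc_nat) (enc_list (enc_pair enc_nat enc_nat))))"

lemma inj_enc_tdigraph: "inj enc_tdigraph"
  unfolding enc_tdigraph_def by (intro inj_enc_pair inj_enc_list inj_enc_nat)

definition enc_roots :: "(nat \<times> nat) list list \<Rightarrow> btree" where
  "enc_roots = enc_list (enc_list (enc_pair enc_nat enc_nat))"

lemma inj_enc_roots: "inj enc_roots"
  unfolding enc_roots_def by (intro inj_enc_pair inj_enc_list inj_enc_nat)

lemma tdigraph_of_surj:
  fixes G :: "nat tdigraph"
  assumes "temporal_digraph G" and "\<forall>v\<in>verts G. finite (active G v)"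
    and "\<forall>v. v \<notin> verts G \<longrightarrow> active G v = {}" and "\<forall>e. e \<notin> edges G \<longrightarrow> labels G e = {}"
  shows "\<exists>g. tdigraph_of g = G"
proof -
  have finV: "finite (verts G)" and E: "edges G \<subseteq> verts G \<times> verts G"
    using assms(1) by (simp_all add: temporal_digraph_def)
  have finE: "finite (edges G)"
    by (rule finite_subset[OF E finite_cartesian_product[OF finV finV]])
  have finL: "finite (labels G e)" if "e \<in> edges G" for e
  proof -
    obtain u v where e: "e = (u, v)" by (cases e)
    have "labels G e \<subseteq> active G u \<times> active G v"
      using assms(1) that unfolding temporal_digraph_def e by auto
    moreover have "finite (active G u \<times> active G v)"
      using E that assms(2) unfolding e by (intro finite_cartesian_product) auto
    ultimately show ?thesis by (rule finite_subset)
  qed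
  obtain vs where vs: "set vs = verts G" using finite_list[OF finV] ..
  obtain es where es: "set es = edges G" using finite_list[OF finE] ..
  define a where "a v = (SOME ts. set ts = active G v)" for v
  have a: "set (a v) = active G v" if "v \<in> verts G" for v
    unfolding a_def by (rule someI_ex) (intro finite_list bspec[OF assms(2)] that)
  define l where "l e = (SOME ls. set ls = labels G e)" for e
  have l: "set (l e) = labels G e" if "e \<in> edges G" for e
    unfolding l_def by (rule someI_ex) (intro finite_list finL that)
  have 1: "(\<lambda>v. \<Union> {set ts | ts. (v, ts) \<in> (\<lambda>v. (v, a v)) ` verts G}) = active G"
  proof
    show "\<Union> {set ts | ts. (v, ts) \<in> (\<lambda>v. (v, a v)) ` verts G} = active G v" for v
    proof (cases "v \<in> verts G")
      case True
      then have "{set ts | ts. (v, ts) \<in> (\<lambda>v. (v, a v)) ` verts G} = {active G v}"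
        using a[OF True] by auto
      then show ?thesis by simp
    next
      case False
      then have "{set ts | ts. (v, ts) \<in> (\<lambda>v. (v, a v)) ` verts G} = {}" by auto
      then show ?thesis using False assms(3) by simp
    qed
  qed
  have 2: "(\<lambda>e. \<Union> {set ls | ls. (e, ls) \<in> (\<lambda>e. (e, l e)) ` edges G}) = labels G"
  proof
    show "\<Union> {set ls | ls. (e, ls) \<in> (\<lambda>e. (e, l e)) ` edges G} = labels G e" for e
    proof (cases "e \<in> edges G")
      case True
      then have "{set ls | ls. (e, ls) \<in> (\<lambda>e. (e, l e)) ` edges G} = {labels G e}"
        using l[OF True] by auto
      then show ?thesis by simp
    next
      case False
      then have "{set ls | ls. (e, ls) \<in> (\<lambda>e. (e, l e)) ` edges G} = {}" by auto
      then show ?thesis using assms(4)[rule_format, OF False] by (simp only: Union_empty)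
    qed
  qed
  have "tdigraph_of (map (\<lambda>v. (v, a v)) vs, map (\<lambda>e. (e, l e)) es) = G"
    unfolding tdigraph_of_def fst_conv snd_conv set_map vs es 1 2 by (simp add: image_image)
  then show ?thesis by blast
qed

end

theory Submission
  imports Defs
begin

text \<open>
  In a spanning branching all waiting steps are available, because every temporal vertex has to be
  present. By uniqueness of walks nothing else may enter \<open>(v, t)\<close> unless \<open>t\<close> is the first active time
  of \<open>v\<close>; in particular roots sit at first active times, and the temporal edges of the branching form
  an ordinary branching in the digraph of those edges \<open>uv\<close> that carry a label arriving at the first
  active time of \<open>v\<close>. Conversely every such branching lifts, by choosing one label per edge. The
  problem thus becomes that of arc-disjoint branchings with prescribed root sets. By Edmonds' theorem
  they exist iff every nonempty vertex set \<open>X\<close> is entered by at least as many arcs as there are root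
  sets avoiding \<open>X\<close>. Lovasz's proof shows that, as long as the condition holds and some branching is
  incomplete, an arc can be handed to it such that the condition persists, and the condition can be
  tested by unit flows; so a greedy algorithm works. All loops range over lists and all loop states are
  sublists of lists computed beforehand, which bounds the running time.
\<close>

section \<open>Closure properties of polynomial time\<close>

text \<open>Edge-disjointness concerns the edges of the underlying digraph, so an edge serves at
  most one branching, and one of its labels is enough: once the first active time of the tail is
  reached, waiting reaches all the others, so the departure time is irrelevant. With gaps in the
  active times a vertex would need several entries, and the reduction to a static digraph would
  break down. The cut condition ranges over exponentially many sets. Fixing a vertex
  \<open>t\<close> turns the sets containing \<open>t\<close> into cuts of one network in which
  every branching index is a source of one unit, so one flow computation per vertex decides it.
  \<open>solve\<close> is total and polynomial on all inputs, and the promise serves correctness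
  only; this is why the closure properties are stated for total functions. Iterating a
  polynomial-time step may square the state each time; hence every loop rule demands a bound on its
  states that depends on the input alone.\<close>

class encodable =
  fixes enc :: "'a \<Rightarrow> btree"
  assumes inj_enc: "inj enc"

lemma enc_eq_iff [simp]: "enc x = enc y \<longleftrightarrow> x = y"
  using inj_enc by (rule inj_eq)

instantiation btree :: encodable
begin
definition enc_btree :: "btree \<Rightarrow> btree" where [simp]: "enc_btree t = t"
instance by standard (simp add: inj_def)
end

instantiation bool :: encodable
begin
definition enc_bool_inst: "enc = enc_bool"
instance
proof
  show "inj (enc :: bool \<Rightarrow> btree)"
    unfolding enc_bool_inst by (rule injI) (metis btree.distinct(1) enc_bool.simps)
qed
end

instantiation nat :: encodable
begin
definition enc_nat_inst: "enc = enc_nat"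
instance by standard (simp add: enc_nat_inst inj_enc_nat)
end

instantiation prod :: (encodable, encodable) encodable
begin
definition enc_prod_inst: "enc = enc_pair enc enc"
instance by standard (simp add: enc_prod_inst inj_enc_pair inj_enc)
end

instantiation list :: (encodable) encodable
begin
definition enc_list_inst: "enc = enc_list enc"
instance by standard (simp add: enc_list_inst inj_enc_list inj_enc)
end

instantiation option :: (encodable) encodable
begin
definition enc_option_inst: "enc = enc_option enc"
instance by standard (simp add: enc_option_inst inj_enc_option inj_enc)
end

lemma enc_simps [simp]:
  "enc False = Leaf" "enc True = Node Leaf Leaf"
  "enc (a, b) = Node (enc a) (enc b)"
  "enc [] = Leaf" "enc (x # xs) = Node (enc x) (enc xs)"
  "enc None = Leaf" "enc (Some y) = Node (enc y) Leaf"
  by (simp_all add: enc_bool_inst enc_prod_inst enc_list_inst enc_option_inst)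

definition size_of :: "'a::encodable \<Rightarrow> nat" where
  "size_of x = nodes (enc x)"

lemma nodes_pos [simp]: "0 < nodes t"
  by (cases t) auto

lemma size_of_pos [simp]: "0 < size_of x"
  by (simp add: size_of_def)

lemma size_of_simps [simp]:
  "size_of (a, b) = 1 + size_of a + size_of b"
  "size_of [] = 1" "size_of (x # xs) = 1 + size_of x + size_of xs"
  by (simp_all add: size_of_def)

lemma size_of_bool_le: "size_of (b::bool) \<le> 3"
  by (cases b) (simp_all add: size_of_def)

subsection \<open>Polynomially bounded functions\<close>

text \<open>Since \<open>size_of x\<close> is positive, the base is at least 2, so constants, sums
  and products are absorbed by raising the exponent.\<close>

definition poly_bounded :: "('a::encodable \<Rightarrow> nat) \<Rightarrow> bool" where
  "poly_bounded T \<longleftrightarrow> (\<exists>d. \<forall>x. T x \<le> (size_of x + 1) ^ d)"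

lemma poly_boundedI: "(\<And>x. T x \<le> (size_of x + 1) ^ d) \<Longrightarrow> poly_bounded T"
  unfolding poly_bounded_def by blast

lemma poly_bounded_mono: "poly_bounded T \<Longrightarrow> (\<And>x. T' x \<le> T x) \<Longrightarrow> poly_bounded T'"
  unfolding poly_bounded_def by (meson order_trans)

lemma poly_bounded_const [intro]: "poly_bounded (\<lambda>x. k)"
proof (rule poly_boundedI)
  fix x :: 'a
  have "k \<le> 2 ^ k" by (simp add: less_imp_le)
  also have "\<dots> \<le> (size_of x + 1) ^ k"
    by (rule power_mono) (use size_of_pos[of x] in linarith)+
  finally show "k \<le> (size_of x + 1) ^ k" .
qed

lemma poly_bounded_size [intro]: "poly_bounded size_of"
  by (rule poly_boundedI[where d = 1]) simp

lemma poly_bounded_add [intro]: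
  assumes "poly_bounded S" "poly_bounded T"
  shows "poly_bounded (\<lambda>x. S x + T x)"
proof -
  obtain d e where S: "\<And>x. S x \<le> (size_of x + 1) ^ d" and T: "\<And>x. T x \<le> (size_of x + 1) ^ e"
    using assms unfolding poly_bounded_def by blast
  show ?thesis
  proof (rule poly_boundedI)
    fix x :: 'a
    let ?B = "size_of x + 1"
    have "S x + T x \<le> ?B ^ (d + e) + ?B ^ (d + e)"
      by (rule add_mono) (rule order_trans[OF S] order_trans[OF T], rule power_increasing; simp)+
    also have "\<dots> = 2 * ?B ^ (d + e)" by simp
    also have "\<dots> \<le> ?B * ?B ^ (d + e)"
      by (rule mult_le_mono1) (use size_of_pos[of x] in linarith)
    finally show "S x + T x \<le> ?B ^ (Suc (d + e))" by simp
  qed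
qed

lemma poly_bounded_mult [intro]:
  assumes "poly_bounded S" "poly_bounded T"
  shows "poly_bounded (\<lambda>x. S x * T x)"
proof -
  obtain d e where "\<And>x. S x \<le> (size_of x + 1) ^ d" and "\<And>x. T x \<le> (size_of x + 1) ^ e"
    using assms unfolding poly_bounded_def by blast
  then have "S x * T x \<le> (size_of x + 1) ^ (d + e)" for x
    unfolding power_add by (rule mult_le_mono)
  then show ?thesis by (rule poly_boundedI)
qed

lemma poly_bounded_power [intro]: "poly_bounded T \<Longrightarrow> poly_bounded (\<lambda>x. T x ^ d)"
  by (induction d) (auto simp del: One_nat_def)

text \<open>\<open>T\<close> depends on the argument itself and not only on its size, so it is first
  replaced by its power bound, which is monotone in the size.\<close>

lemma poly_bounded_comp:
  assumes "poly_bounded T" "poly_bounded (\<lambda>x. size_of (f x))"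
  shows "poly_bounded (\<lambda>x. T (f x))"
proof -
  obtain d where "\<And>x. T x \<le> (size_of x + 1) ^ d"
    using assms unfolding poly_bounded_def by blast
  then have "\<And>x. T (f x) \<le> (size_of (f x) + 1) ^ d" .
  moreover have "poly_bounded (\<lambda>x. (size_of (f x) + 1) ^ d)"
    using assms(2) by (intro poly_bounded_power poly_bounded_add poly_bounded_const)
  ultimately show ?thesis by (rule poly_bounded_mono[rotated])
qed

subsection \<open>Programs computing functions\<close>

text \<open>The last clause is the frame condition: the program may use variables below \<open>N\<close> as scratch
  space, with arbitrary initial contents, and leaves all others alone.\<close>

definition computes ::
    "prog \<Rightarrow> nat \<Rightarrow> ('a \<Rightarrow> nat) \<Rightarrow> ('a::encodable \<Rightarrow> 'b::encodable) \<Rightarrow> bool" where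
  "computes c N T f \<longleftrightarrow> 0 < N \<and> poly_bounded T \<and>
     (\<forall>x s. s 0 = enc x \<longrightarrow>
        (\<exists>n s'. exec c s n s' \<and> n \<le> T x \<and> s' 0 = enc (f x) \<and> (\<forall>y\<ge>N. s' y = s y)))"

definition polytime :: "('a::encodable \<Rightarrow> 'b::encodable) \<Rightarrow> bool" where
  "polytime f \<longleftrightarrow> (\<exists>c N T. computes c N T f)"

lemma computesD:
  "computes c N T f \<Longrightarrow> s 0 = enc x \<Longrightarrow>
    \<exists>n s'. exec c s n s' \<and> n \<le> T x \<and> s' 0 = enc (f x) \<and> (\<forall>y\<ge>N. s' y = s y)"
  unfolding computes_def by blast

lemma computes_pos: "computes c N T f \<Longrightarrow> 0 < N"
  by (simp add: computes_def)

lemma computes_poly_bounded: "computes c N T f \<Longrightarrow> poly_bounded T"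
  by (simp add: computes_def)

lemma polytimeE:
  assumes "polytime f"
  obtains c N T where "computes c N T f"
  using assms unfolding polytime_def by blast

lemma polytimeI:
  assumes "0 < N" "poly_bounded T"
    "\<And>x s. s 0 = enc x \<Longrightarrow>
        \<exists>n s'. exec c s n s' \<and> n \<le> T x \<and> s' 0 = enc (f x) \<and> (\<forall>y\<ge>N. s' y = s y)"
  shows "polytime f"
  using assms unfolding polytime_def computes_def by blast

text \<open>An assignment is charged the size of the value it stores, so a variable that has changed
  holds a value paid for by the run. This turns time bounds into bounds on the output size, on which
  composition relies.\<close>

lemma exec_nodes_le: "exec c s n s' \<Longrightarrow> s' x = s x \<or> nodes (s' x) \<le> n"
proof (induction rule: exec.induct)
  case (Seq c1 s m s' c2 n s'')
  then show ?case by auto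
qed auto

lemma polytime_size:
  assumes "polytime f"
  shows "poly_bounded (\<lambda>x. size_of (f x))"
proof -
  obtain c N T where c: "computes c N T f" using assms by (rule polytimeE)
  have "size_of (f x) \<le> size_of x + T x" for x
  proof -
    obtain n s' where "exec c (\<lambda>_. enc x) n s'" "n \<le> T x" "s' 0 = enc (f x)"
      using computesD[OF c, of "\<lambda>_. enc x" x] by blast
    then show ?thesis using exec_nodes_le[of c "\<lambda>_. enc x" n s' 0]
      by (auto simp: size_of_def)
  qed
  moreover have "poly_bounded (\<lambda>x. size_of x + T x)"
    using computes_poly_bounded[OF c] by (intro poly_bounded_add poly_bounded_size)
  ultimately show ?thesis by (rule poly_bounded_mono[rotated])
qed

lemma polytime_comp:
  assumes "polytime g" "polytime f"
  shows "polytime (\<lambda>x. g (f x))"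
proof -
  obtain c N T c' N' T' where c: "computes c N T f" and c': "computes c' N' T' g"
    using assms by (elim polytimeE)
  show ?thesis
  proof (rule polytimeI)
    show "0 < max N N'" using computes_pos[OF c] by simp
    show "poly_bounded (\<lambda>x. T x + T' (f x))"
      using computes_poly_bounded[OF c] computes_poly_bounded[OF c'] polytime_size[OF assms(2)]
      by (rule poly_bounded_add[OF _ poly_bounded_comp])
    fix x :: 'c and s :: store assume "s 0 = enc x"
    then obtain n s' where 1: "exec c s n s'" "n \<le> T x" "s' 0 = enc (f x)" "\<forall>y\<ge>N. s' y = s y"
      using computesD[OF c, of s x] by blast
    from 1(3) obtain m s'' where 2: "exec c' s' m s''" "m \<le> T' (f x)" "s'' 0 = enc (g (f x))"
      "\<forall>y\<ge>N'. s'' y = s' y"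
      using computesD[OF c', of s' "f x"] by blast
    show "\<exists>n s'. exec (Seq c c') s n s' \<and> n \<le> T x + T' (f x) \<and> s' 0 = enc (g (f x)) \<and>
        (\<forall>y\<ge>max N N'. s' y = s y)"
      by (intro exI[of _ "n + m"] exI[of _ s''])
        (use 1 2 in \<open>auto intro: exec.Seq\<close>)
  qed
qed

lemma polytime_expr:
  assumes "\<And>x s. s 0 = enc x \<Longrightarrow> val e s = enc (f x)" "poly_bounded (\<lambda>x. size_of (f x))"
  shows "polytime f"
proof (rule polytimeI[where N = 1 and T = "\<lambda>x. 1 + size_of (f x)" and c = "Assign 0 e"])
  show "poly_bounded (\<lambda>x. 1 + size_of (f x))"
    using assms(2) by (intro poly_bounded_add poly_bounded_const)
  fix x :: 'a and s :: store assume "s 0 = enc x"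
  then have "val e s = enc (f x)" by (rule assms(1))
  then show "\<exists>n s'. exec (Assign 0 e) s n s' \<and> n \<le> 1 + size_of (f x) \<and> s' 0 = enc (f x) \<and>
      (\<forall>y\<ge>1. s' y = s y)"
    using exec.Assign[of 0 e s] by (auto simp: size_of_def intro!: exI)
qed simp

text \<open>A function that leaves the tree unchanged costs one copy. This covers changes of type,
  such as from pairs to lists or from numerals to digit lists.\<close>

lemma polytime_recode: "(\<And>x. enc (f x) = enc x) \<Longrightarrow> polytime f"
  by (rule polytime_expr[of "Var 0"]) (auto simp: size_of_def[symmetric] size_of_def[of "f _"])

lemma polytime_id: "polytime (\<lambda>x. x)"
  by (rule polytime_recode) simp

lemma const_expr: "\<exists>e. \<forall>s. val e s = t"
proof (induction t)
  case Leaf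
  then show ?case by (intro exI[of _ ELeaf]) simp
next
  case (Node l r)
  then obtain a b where "\<forall>s. val a s = l" "\<forall>s. val b s = r" by blast
  then show ?case by (intro exI[of _ "ENode a b"]) simp
qed

lemma polytime_const: "polytime (\<lambda>x. k)"
proof -
  obtain e where "\<forall>s. val e s = enc k" using const_expr by blast
  then show ?thesis by (intro polytime_expr) auto
qed

text \<open>Programs overwrite their input, so a copy is parked beyond the scratch space of
  \<open>c\<close>, where the frame condition protects it. Used when several functions share an
  argument and for loop tests.\<close>

definition stash :: "prog \<Rightarrow> nat \<Rightarrow> prog" where
  "stash c M = Seq (Assign M (Var 0)) (Seq c (Seq (Assign (M + 1) (Var 0)) (Assign 0 (Var M))))"

lemma exec_stash:
  assumes c: "computes c N T f" and M: "N \<le> M" and s: "s 0 = enc x"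
  shows "\<exists>n s'. exec (stash c M) s n s' \<and> n \<le> 3 + 2 * size_of x + size_of (f x) + T x \<and>
    s' 0 = enc x \<and> s' (M + 1) = enc (f x) \<and> (\<forall>y\<ge>M + 2. s' y = s y)"
proof -
  have M0: "M > 0" using computes_pos[OF c] M by simp
  let ?s1 = "s(M := enc x)"
  have 1: "exec (Assign M (Var 0)) s (1 + size_of x) ?s1"
    using exec.Assign[of M "Var 0" s] s by (simp add: size_of_def)
  have "?s1 0 = enc x" using s M0 by simp
  then obtain n s2 where 2: "exec c ?s1 n s2" "n \<le> T x" "s2 0 = enc (f x)"
    "\<forall>y\<ge>N. s2 y = ?s1 y"
    using computesD[OF c, of ?s1 x] by blast
  let ?s3 = "s2(M + 1 := enc (f x))"
  have 3: "exec (Assign (M + 1) (Var 0)) s2 (1 + size_of (f x)) ?s3"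
    using exec.Assign[of "M + 1" "Var 0" s2] 2(3) by (simp add: size_of_def)
  let ?s4 = "?s3(0 := enc x)"
  have "?s3 M = enc x" using 2(4) M by simp
  then have 4: "exec (Assign 0 (Var M)) ?s3 (1 + size_of x) ?s4"
    using exec.Assign[of 0 "Var M" ?s3] by (simp add: size_of_def)
  have "exec (stash c M) s (1 + size_of x + (n + (1 + size_of (f x) + (1 + size_of x)))) ?s4"
    unfolding stash_def by (intro exec.Seq) (rule 1 2 3 4)+
  then show ?thesis
    by (intro exI conjI) (assumption, use 2 M in auto)
qed

lemma poly_bounded_stash:
  assumes "computes c N T f"
  shows "poly_bounded (\<lambda>x. 3 + 2 * size_of x + size_of (f x) + T x)"
  using assms polytime_size[of f] computes_poly_bounded[OF assms] unfolding polytime_def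
  by (intro poly_bounded_add poly_bounded_mult poly_bounded_const poly_bounded_size) blast+

lemma polytime_Pair:
  assumes "polytime f" "polytime g"
  shows "polytime (\<lambda>x. (f x, g x))"
proof -
  obtain c N T c' N' T' where c: "computes c N T f" and c': "computes c' N' T' g"
    using assms by (elim polytimeE)
  define M where "M = max N N'"
  have NM: "N \<le> M" by (simp add: M_def)
  define P where "P = Seq (stash c M) (Seq c' (Assign 0 (ENode (Var (M + 1)) (Var 0))))"
  show ?thesis
  proof (rule polytimeI)
    show "0 < M + 2" by simp
    show "poly_bounded (\<lambda>x. (3 + 2 * size_of x + size_of (f x) + T x) +
        (T' x + (1 + (1 + size_of (f x) + size_of (g x)))))"
      using poly_bounded_stash[OF c] computes_poly_bounded[OF c'] polytime_size[OF assms(2)]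
        polytime_size[OF assms(1)]
      by (simp only: poly_bounded_add poly_bounded_const)
    fix x :: 'a and s :: store assume "s 0 = enc x"
    then obtain n s' where 1: "exec (stash c M) s n s'"
      "n \<le> 3 + 2 * size_of x + size_of (f x) + T x"
      "s' 0 = enc x" "s' (M + 1) = enc (f x)" "\<forall>y\<ge>M + 2. s' y = s y"
      using exec_stash[OF c NM, of s x] by blast
    from 1(3) obtain m s'' where 2: "exec c' s' m s''" "m \<le> T' x" "s'' 0 = enc (g x)"
      "\<forall>y\<ge>N'. s'' y = s' y"
      using computesD[OF c', of s' x] by blast
    have 3: "s'' (M + 1) = enc (f x)" using 2(4) 1(4) by (simp add: M_def)
    have 4: "exec (Assign 0 (ENode (Var (M + 1)) (Var 0))) s'' (1 + size_of (f x, g x))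
        (s''(0 := enc (f x, g x)))"
      using exec.Assign[of 0 "ENode (Var (M + 1)) (Var 0)" s''] 3 2(3)
      by (simp add: size_of_def)
    have "exec P s (n + (m + (1 + size_of (f x, g x)))) (s''(0 := enc (f x, g x)))"
      unfolding P_def by (intro exec.Seq) (rule 1 2 4)+
    then show "\<exists>n s'. exec P s n s' \<and> n \<le> (3 + 2 * size_of x + size_of (f x) + T x) +
        (T' x + (1 + (1 + size_of (f x) + size_of (g x)))) \<and> s' 0 = enc (f x, g x) \<and>
        (\<forall>y\<ge>M + 2. s' y = s y)"
      by (intro exI[of _ "n + (m + (1 + size_of (f x, g x)))"] exI[of _ "s''(0 := enc (f x, g x))"])
        (use 1 2 in \<open>auto simp: M_def\<close>)
  qed
qed

lemma polytime_If:
  assumes "polytime b" "polytime f" "polytime g"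
  shows "polytime (\<lambda>x. if b x then f x else g x)"
proof -
  obtain c N T c' N' T' c'' N'' T'' where
    c: "computes c N T b" and c': "computes c' N' T' f" and c'': "computes c'' N'' T'' g"
    using assms by (elim polytimeE)
  define M where "M = max N (max N' N'')"
  have NM: "N \<le> M" by (simp add: M_def)
  define P where "P = Seq (stash c M) (If (Var (M + 1)) c' c'')"
  show ?thesis
  proof (rule polytimeI)
    show "0 < M + 2" by simp
    show "poly_bounded (\<lambda>x. (3 + 2 * size_of x + size_of (b x) + T x) + (1 + (T' x + T'' x)))"
      using poly_bounded_stash[OF c] computes_poly_bounded[OF c'] computes_poly_bounded[OF c'']
      by (simp only: poly_bounded_add poly_bounded_const)
    fix x :: 'a and s :: store assume "s 0 = enc x"
    then obtain n s' where 1: "exec (stash c M) s n s'"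
      "n \<le> 3 + 2 * size_of x + size_of (b x) + T x"
      "s' 0 = enc x" "s' (M + 1) = enc (b x)" "\<forall>y\<ge>M + 2. s' y = s y"
      using exec_stash[OF c NM, of s x] by blast
    have "\<exists>m s''. exec (If (Var (M + 1)) c' c'') s' m s'' \<and> m \<le> 1 + (T' x + T'' x) \<and>
        s'' 0 = enc (if b x then f x else g x) \<and> (\<forall>y\<ge>M+2. s'' y = s' y)"
    proof (cases "b x")
      case True
      from 1(3) obtain m s'' where "exec c' s' m s''" "m \<le> T' x" "s'' 0 = enc (f x)"
        "\<forall>y\<ge>N'. s'' y = s' y"
        using computesD[OF c', of s' x] by blast
      moreover from this(1) have "exec (If (Var (M + 1)) c' c'') s' (1 + m) s''"
        by (rule exec.IfTrue[rotated]) (use True 1(4) in simp)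
      ultimately show ?thesis using True
        by (intro exI[of _ "1 + m"] exI[of _ s'']) (simp add: M_def)
    next
      case False
      from 1(3) obtain m s'' where "exec c'' s' m s''" "m \<le> T'' x" "s'' 0 = enc (g x)"
        "\<forall>y\<ge>N''. s'' y = s' y"
        using computesD[OF c'', of s' x] by blast
      moreover from this(1) have "exec (If (Var (M + 1)) c' c'') s' (1 + m) s''"
        by (rule exec.IfFalse[rotated]) (use False 1(4) in simp)
      ultimately show ?thesis using False
        by (intro exI[of _ "1 + m"] exI[of _ s'']) (simp add: M_def)
    qed
    then obtain m s'' where 2: "exec (If (Var (M + 1)) c' c'') s' m s''" "m \<le> 1 + (T' x + T'' x)"
      "s'' 0 = enc (if b x then f x else g x)" "\<forall>y\<ge>M+2. s'' y = s' y" by blast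
    have "exec P s (n + m) s''"
      unfolding P_def by (rule exec.Seq) (rule 1 2)+
    then show "\<exists>n s'. exec P s n s' \<and>
        n \<le> (3 + 2 * size_of x + size_of (b x) + T x) + (1 + (T' x + T'' x)) \<and>
        s' 0 = enc (if b x then f x else g x) \<and> (\<forall>y\<ge>M + 2. s' y = s y)"
      using 1 2 by (intro exI[of _ "n + m"] exI[of _ s'']) (auto simp del: enc_simps)
  qed
qed

text \<open>A round costs a polynomial in the size of the state, which \<open>S x\<close> bounds,
  and there are at most \<open>\<mu> (i x)\<close> rounds. Because \<open>fin\<close> determines the
  entire final state, uses let \<open>r\<close> include the leftovers of the loop, such as an
  exhausted worklist, and project afterwards.\<close>

lemma polytime_while:
  fixes I :: "'x::encodable \<Rightarrow> 'a::encodable \<Rightarrow> bool"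
  assumes i: "polytime i" and b: "polytime b" and f: "polytime f"
    and init: "\<And>x. I x (i x)"
    and step: "\<And>x y. I x y \<Longrightarrow> b y \<Longrightarrow> I x (f y)"
    and fin: "\<And>x y. I x y \<Longrightarrow> \<not> b y \<Longrightarrow> y = r x"
    and S: "poly_bounded S" "\<And>x y. I x y \<Longrightarrow> size_of y \<le> S x"
    and K: "poly_bounded K" "\<And>x. \<mu> (i x) \<le> K x"
    and dec: "\<And>x y. I x y \<Longrightarrow> b y \<Longrightarrow> \<mu> (f y) < (\<mu> y :: nat)"
  shows "polytime r"
proof -
  obtain c0 N0 T0 c1 N1 T1 c2 N2 T2 where
    c0: "computes c0 N0 T0 i" and c1: "computes c1 N1 T1 b" and c2: "computes c2 N2 T2 f"
    using i b f by (elim polytimeE)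
  define M where "M = max N0 (max N1 N2)"
  have NM: "N1 \<le> M" by (simp add: M_def)
  \<comment> \<open>\<open>M + 1\<close> holds the value of the test for the current state; the body
    ends by recomputing it.\<close>
  define W where "W = While (Var (M + 1)) (Seq c2 (stash c1 M))"
  define T3 where "T3 y = 3 + 2 * size_of y + size_of (b y) + T1 y" for y
  have "poly_bounded (\<lambda>y. T2 y + T3 (f y))" "poly_bounded T3"
    unfolding T3_def using computes_poly_bounded[OF c2]
      poly_bounded_comp[OF poly_bounded_stash[OF c1] polytime_size[OF f]] poly_bounded_stash[OF c1]
    by auto
  then obtain d e where d: "\<And>y. T2 y + T3 (f y) \<le> (size_of y + 1) ^ d"
    and e: "\<And>y. T3 y \<le> (size_of y + 1) ^ e"
    unfolding poly_bounded_def by blast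
  have loop: "\<exists>n s'. exec W s n s' \<and> n \<le> 1 + \<mu> y * (1 + (S x + 1) ^ d) \<and> s' 0 = enc (r x) \<and>
      (\<forall>z\<ge>M+2. s' z = s z)"
    if "I x y" "s 0 = enc y" "s (M + 1) = enc (b y)" for x y s
    using that
  proof (induction "\<mu> y" arbitrary: y s rule: less_induct)
    case less
    show ?case
    proof (cases "b y")
      case False
      then have "r x = y" using fin less.prems(1) by auto
      then show ?thesis using False less.prems
        unfolding W_def by (intro exI[of _ 1] exI[of _ s] conjI exec.WhileFalse) simp_all
    next
      case True
      from less.prems(2) obtain n s' where 1: "exec c2 s n s'" "n \<le> T2 y" "s' 0 = enc (f y)"
        "\<forall>z\<ge>N2. s' z = s z"
        using computesD[OF c2, of s y] by blast
      obtain m s'' where 2: "exec (stash c1 M) s' m s''" "m \<le> T3 (f y)" "s'' 0 = enc (f y)"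
        "s'' (M + 1) = enc (b (f y))" "\<forall>z\<ge>M + 2. s'' z = s' z"
        using exec_stash[OF c1 NM, of s' "f y"] 1(3) unfolding T3_def by blast
      have lt: "\<mu> (f y) < \<mu> y" using dec less.prems(1) True .
      from less.hyps[OF lt step[OF less.prems(1) True] 2(3) 2(4)] obtain l t where
        3: "exec W s'' l t" "l \<le> 1 + \<mu> (f y) * (1 + (S x + 1) ^ d)" "t 0 = enc (r x)"
        "\<forall>z\<ge>M+2. t z = s'' z" by blast
      have "exec W s (1 + (n + m) + l) t"
        unfolding W_def
        by (rule exec.WhileTrue[OF _ exec.Seq[OF 1(1) 2(1)] 3(1)[unfolded W_def]])
          (use less.prems(3) True in simp)
      moreover have "1 + (n + m) + l \<le> 1 + \<mu> y * (1 + (S x + 1) ^ d)"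
      proof -
        have "n + m \<le> (size_of y + 1) ^ d" using 1(2) 2(2) d[of y] by linarith
        also have "\<dots> \<le> (S x + 1) ^ d" using S(2)[OF less.prems(1)] by (intro power_mono) auto
        finally have "1 + (n + m) + l \<le> 1 + (Suc (\<mu> (f y))) * (1 + (S x + 1) ^ d)"
          using 3(2) by (simp only: mult_Suc)
        also have "\<dots> \<le> 1 + \<mu> y * (1 + (S x + 1) ^ d)"
          using lt by (intro add_left_mono mult_le_mono1) simp
        finally show ?thesis .
      qed
      ultimately show ?thesis using 1 2 3
        by (intro exI[of _ "1 + (n + m) + l"] exI[of _ t]) (auto simp: M_def)
    qed
  qed
  show ?thesis
  proof (rule polytimeI)
    show "0 < M + 2" by simp
    show "poly_bounded (\<lambda>x. T0 x + ((S x + 1) ^ e + (1 + K x * (1 + (S x + 1) ^ d))))"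
      using S(1) K(1) computes_poly_bounded[OF c0]
      by (intro poly_bounded_add poly_bounded_mult poly_bounded_power poly_bounded_const)
    fix x :: 'x and s :: store assume "s 0 = enc x"
    then obtain n s' where 1: "exec c0 s n s'" "n \<le> T0 x" "s' 0 = enc (i x)"
        "\<forall>z\<ge>N0. s' z = s z"
      using computesD[OF c0, of s x] by blast
    obtain m s'' where 2: "exec (stash c1 M) s' m s''" "m \<le> T3 (i x)" "s'' 0 = enc (i x)"
      "s'' (M + 1) = enc (b (i x))" "\<forall>z\<ge>M + 2. s'' z = s' z"
      using exec_stash[OF c1 NM, of s' "i x"] 1(3) unfolding T3_def by blast
    from loop[OF init 2(3) 2(4)] obtain l t where 3: "exec W s'' l t"
      "l \<le> 1 + \<mu> (i x) * (1 + (S x + 1) ^ d)" "t 0 = enc (r x)" "\<forall>z\<ge>M+2. t z = s'' z" by blast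
    have "T3 (i x) \<le> (S x + 1) ^ e"
      by (rule order_trans[OF e]) (use S(2)[OF init, of x] in \<open>auto intro: power_mono\<close>)
    moreover have "\<mu> (i x) * (1 + (S x + 1) ^ d) \<le> K x * (1 + (S x + 1) ^ d)"
      by (rule mult_le_mono1[OF K(2)])
    ultimately have "n + (m + l) \<le> T0 x + ((S x + 1) ^ e + (1 + K x * (1 + (S x + 1) ^ d)))"
      using 1(2) 2(2) 3(2) by linarith
    moreover have "exec (Seq c0 (Seq (stash c1 M) W)) s (n + (m + l)) t"
      by (intro exec.Seq) (rule 1 2 3)+
    ultimately show "\<exists>n s'. exec (Seq c0 (Seq (stash c1 M) W)) s n s' \<and>
       n \<le> T0 x + ((S x + 1) ^ e + (1 + K x * (1 + (S x + 1) ^ d))) \<and> s' 0 = enc (r x) \<and>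
       (\<forall>y\<ge>M + 2. s' y = s y)"
      using 1 2 3 by (intro exI[of _ "n + (m + l)"] exI[of _ t]) (auto simp: M_def)
  qed
qed

lemma solvable_if_polytime:
  assumes "polytime f" "\<And>x. P x \<Longrightarrow> Q x (f x)"
  shows "solvable_in_polynomial_time enc enc P Q"
proof -
  obtain c N T where c: "computes c N T f" using assms(1) by (rule polytimeE)
  then obtain d where d: "\<And>x. T x \<le> (size_of x + 1) ^ d"
    using computes_poly_bounded unfolding poly_bounded_def by blast
  have "\<exists>n s y. exec c ((\<lambda>_. Leaf)(0 := enc x)) n s \<and> n \<le> poly ([:1, 1:] ^ d) (nodes (enc x)) \<and>
      s 0 = enc y \<and> Q x y" if "P x" for x
  proof -
    obtain n s where "exec c ((\<lambda>_. Leaf)(0 := enc x)) n s" "n \<le> T x" "s 0 = enc (f x)"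
      using computesD[OF c, of "(\<lambda>_. Leaf)(0 := enc x)" x] by auto
    moreover have "poly ([:1, 1:] ^ d) (nodes (enc x)) = (size_of x + 1) ^ d"
      by (simp add: poly_power size_of_def)
    ultimately show ?thesis using assms(2)[OF that] d[of x] by (metis order_trans)
  qed
  then show ?thesis unfolding solvable_in_polynomial_time_def by blast
qed

subsection \<open>Data types\<close>

named_theorems polytime_intros

declare polytime_id [polytime_intros] polytime_const [polytime_intros]
  polytime_Pair [polytime_intros] polytime_If [polytime_intros]

lemma polytime_cong: "polytime f \<Longrightarrow> (\<And>x. f x = g x) \<Longrightarrow> polytime g"
  by (metis ext)

text \<open>Expressions cannot branch, so a function defined by cases on a constructor needs a
  program with one test, here of whether the encoded argument is a leaf.\<close>

lemma polytime_cases: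
  assumes "\<And>x s. s 0 = enc x \<Longrightarrow> enc x \<noteq> Leaf \<Longrightarrow> val e s = enc (f x)"
    and "\<And>x s. s 0 = enc x \<Longrightarrow> enc x = Leaf \<Longrightarrow> val e' s = enc (f x)"
    and "poly_bounded (\<lambda>x. size_of (f x))"
  shows "polytime f"
proof (rule polytimeI[where N = 1 and T = "\<lambda>x. 2 + size_of (f x)" and
      c = "If (Var 0) (Assign 0 e) (Assign 0 e')"])
  show "poly_bounded (\<lambda>x. 2 + size_of (f x))"
    using assms(3) by (intro poly_bounded_add poly_bounded_const)
  fix x :: 'a and s :: store assume s: "s 0 = enc x"
  have "exec (If (Var 0) (Assign 0 e) (Assign 0 e')) s (1 + (1 + size_of (f x))) (s(0 := enc (f x)))"
  proof (cases "enc x = Leaf")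
    case True
    have "exec (Assign 0 e') s (1 + size_of (f x)) (s(0 := enc (f x)))"
      using exec.Assign[of 0 e' s] assms(2)[of s x] s True by (simp add: size_of_def)
    then show ?thesis using True s by (intro exec.IfFalse) auto
  next
    case False
    have "exec (Assign 0 e) s (1 + size_of (f x)) (s(0 := enc (f x)))"
      using exec.Assign[of 0 e s] assms(1)[of s x] s False by (simp add: size_of_def)
    then show ?thesis using False s by (intro exec.IfTrue) auto
  qed
  then show "\<exists>n s'. exec (If (Var 0) (Assign 0 e) (Assign 0 e')) s n s' \<and> n \<le> 2 + size_of (f x) \<and>
      s' 0 = enc (f x) \<and> (\<forall>y\<ge>1. s' y = s y)"
    by (intro exI conjI) (assumption, auto)
qed simp

lemma polytime_test: "(\<And>x. b x \<longleftrightarrow> enc x \<noteq> Leaf) \<Longrightarrow> polytime b"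
  by (rule polytime_cases[of "ENode ELeaf ELeaf" _ ELeaf])
    (auto intro: poly_bounded_mono[OF poly_bounded_const size_of_bool_le])

lemma polytime_fst [polytime_intros]:
  assumes "polytime f"
  shows "polytime (\<lambda>x. fst (f x))"
proof -
  have "polytime (fst :: 'b \<times> 'c \<Rightarrow> 'b)"
    by (rule polytime_expr[of "ELeft (Var 0)"])
      (auto intro: poly_bounded_mono[OF poly_bounded_size])
  then show ?thesis using assms by (rule polytime_comp)
qed

lemma polytime_snd [polytime_intros]:
  assumes "polytime f"
  shows "polytime (\<lambda>x. snd (f x))"
proof -
  have "polytime (snd :: 'b \<times> 'c \<Rightarrow> 'c)"
    by (rule polytime_expr[of "ERight (Var 0)"])
      (auto intro: poly_bounded_mono[OF poly_bounded_size])
  then show ?thesis using assms by (rule polytime_comp)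
qed

lemma polytime_case_prod [polytime_intros]:
  "polytime (\<lambda>x. f x (fst (g x)) (snd (g x))) \<Longrightarrow> polytime (\<lambda>x. case g x of (a, b) \<Rightarrow> f x a b)"
  by (simp add: case_prod_beta)

lemma polytime_conj [polytime_intros]:
  assumes "polytime f" "polytime g"
  shows "polytime (\<lambda>x. f x \<and> g x)"
proof -
  have "polytime (\<lambda>x. if f x then g x else False)"
    using assms by (intro polytime_intros)
  then show ?thesis by (rule polytime_cong) auto
qed

lemma polytime_Not [polytime_intros]:
  assumes "polytime f"
  shows "polytime (\<lambda>x. \<not> f x)"
proof -
  have "polytime (\<lambda>x. if f x then False else True)"
    using assms by (intro polytime_intros)
  then show ?thesis by (rule polytime_cong) auto
qed

lemma polytime_disj [polytime_intros]:
  assumes "polytime f" "polytime g"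
  shows "polytime (\<lambda>x. f x \<or> g x)"
proof -
  have "polytime (\<lambda>x. if f x then True else g x)"
    using assms by (intro polytime_intros)
  then show ?thesis by (rule polytime_cong) auto
qed

lemma polytime_imp [polytime_intros]:
  assumes "polytime f" "polytime g"
  shows "polytime (\<lambda>x. f x \<longrightarrow> g x)"
proof -
  have "polytime (\<lambda>x. \<not> f x \<or> g x)"
    using assms by (intro polytime_intros)
  then show ?thesis by (rule polytime_cong) auto
qed

lemma polytime_Cons [polytime_intros]:
  assumes "polytime f" "polytime g"
  shows "polytime (\<lambda>x. f x # g x)"
proof -
  have "polytime (\<lambda>p. fst p # snd p :: 'b list)"
    by (rule polytime_recode) auto
  from polytime_comp[OF this polytime_Pair[OF assms]] show ?thesis by simp
qed

lemma polytime_tl [polytime_intros]: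
  assumes "polytime f"
  shows "polytime (\<lambda>x. tl (f x))"
proof -
  have "polytime (tl :: 'b list \<Rightarrow> _)"
  proof (rule polytime_expr[of "ERight (Var 0)"])
    show "val (ERight (Var 0)) s = enc (tl x)" if "s 0 = enc x" for s and x :: "'b list"
      using that by (cases x) auto
    have "size_of (tl x) \<le> size_of x" for x :: "'b list"
      by (cases x) auto
    then show "poly_bounded (\<lambda>x :: 'b list. size_of (tl x))"
      by (rule poly_bounded_mono[OF poly_bounded_size])
  qed
  then show ?thesis using assms by (rule polytime_comp)
qed

lemma polytime_not_Nil [polytime_intros]:
  assumes "polytime f"
  shows "polytime (\<lambda>x. f x \<noteq> [])"
proof -
  have "polytime (\<lambda>xs :: 'b list. xs \<noteq> [])"
  proof (rule polytime_test)
    show "(xs \<noteq> []) = (enc xs \<noteq> Leaf)" for xs :: "'b list" by (cases xs) auto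
  qed
  then show ?thesis using assms by (rule polytime_comp)
qed

lemma polytime_hd [polytime_intros]:
  assumes "polytime f"
  shows "polytime (\<lambda>x. hd (f x))"
proof -
  have "polytime (hd :: 'b list \<Rightarrow> _)"
  proof -
    obtain e where e: "\<forall>s. val e s = enc (hd [] :: 'b)" using const_expr by blast
    show ?thesis
    proof (rule polytime_cases[of "ELeft (Var 0)" _ e])
      show "val (ELeft (Var 0)) s = enc (hd x)" if "s 0 = enc x" "enc x \<noteq> Leaf"
        for s and x :: "'b list"
        using that by (cases x) auto
      show "val e s = enc (hd x)" if "s 0 = enc x" "enc x = Leaf" for s and x :: "'b list"
        using that e by (cases x) auto
      have "size_of (hd x) \<le> size_of x + size_of (hd [] :: 'b)" for x :: "'b list"
        by (cases x) auto
      then show "poly_bounded (\<lambda>x :: 'b list. size_of (hd x))"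
        by (rule poly_bounded_mono[OF poly_bounded_add[OF poly_bounded_size poly_bounded_const]])
    qed
  qed
  then show ?thesis using assms by (rule polytime_comp)
qed

lemma polytime_Some [polytime_intros]:
  assumes "polytime f"
  shows "polytime (\<lambda>x. Some (f x))"
proof -
  have "size_of (Some x) \<le> size_of x + 2" for x :: 'b
    by (simp add: size_of_def)
  then have "poly_bounded (\<lambda>x::'b. size_of (Some x))"
    by (rule poly_bounded_mono[OF poly_bounded_add[OF poly_bounded_size poly_bounded_const]])
  then have "polytime (Some :: 'b \<Rightarrow> _)"
    by (intro polytime_expr[of "ENode (Var 0) ELeaf"]) auto
  then show ?thesis using assms by (rule polytime_comp)
qed

subsection \<open>Equality\<close>

text \<open>The list holds the pairs of subtrees still to be compared; a mismatch empties it, which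
  also stops the loop.\<close>

definition tree_eq_step :: "bool \<times> (btree \<times> btree) list \<Rightarrow> bool \<times> (btree \<times> btree) list" where
  "tree_eq_step st =
     (let a = fst (hd (snd st)); b = snd (hd (snd st)); r = tl (snd st) in
      if a \<noteq> Leaf then if b \<noteq> Leaf then (fst st, (left a, left b) # (right a, right b) # r) else (False, [])
      else if b \<noteq> Leaf then (False, []) else (fst st, r))"

lemma polytime_left: "polytime f \<Longrightarrow> polytime (\<lambda>x. left (f x))"
proof (rule polytime_comp[of left f])
  have "size_of (left x) \<le> size_of x" for x by (cases x) (auto simp: size_of_def)
  then show "polytime left"
    by (intro polytime_expr[of "ELeft (Var 0)"] poly_bounded_mono[OF poly_bounded_size]) auto
qed

lemma polytime_right: "polytime f \<Longrightarrow> polytime (\<lambda>x. right (f x))"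
proof (rule polytime_comp[of right f])
  have "size_of (right x) \<le> size_of x" for x by (cases x) (auto simp: size_of_def)
  then show "polytime right"
    by (intro polytime_expr[of "ERight (Var 0)"] poly_bounded_mono[OF poly_bounded_size]) auto
qed

lemma polytime_not_Leaf: "polytime f \<Longrightarrow> polytime (\<lambda>x. f x \<noteq> Leaf)"
  by (rule polytime_comp[of "\<lambda>x. x \<noteq> Leaf" f]) (rule polytime_test, auto)

text \<open>Splitting a pair of inner nodes keeps the size of the worklist: the two removed roots
  pay for the additional list cell and pair. The measure drops in every step because each first
  component has at least one node.\<close>

lemma polytime_tree_eq: "polytime (\<lambda>p::btree \<times> btree. fst p = snd p)"
proof -
  let ?I = "\<lambda>p st. (fst st \<and> (\<forall>q\<in>set (snd st). fst q = snd q) \<longleftrightarrow> fst p = snd p) \<and>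
    size_of (snd st) \<le> size_of p + 2"
  let ?\<mu> = "\<lambda>st :: bool \<times> (btree \<times> btree) list. \<Sum>q\<leftarrow>snd st. nodes (fst q)"
  let ?r = "\<lambda>p::btree \<times> btree. (fst p = snd p, [] :: (btree \<times> btree) list)"
  have "polytime ?r"
  proof (rule polytime_while[where i = "\<lambda>p. (True, [p])" and b = "\<lambda>st. snd st \<noteq> []" and
        f = tree_eq_step and I = ?I and \<mu> = ?\<mu> and K = size_of])
    show "polytime tree_eq_step"
      unfolding tree_eq_step_def Let_def
      by (intro polytime_intros polytime_left polytime_right polytime_not_Leaf)
    show "polytime (\<lambda>p :: btree \<times> btree. (True, [p]))"
      "polytime (\<lambda>st :: bool \<times> (btree \<times> btree) list. snd st \<noteq> [])"
      by (intro polytime_intros)+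
    show "?I p (True, [p])" for p :: "btree \<times> btree" by auto
    fix p :: "btree \<times> btree" and st :: "bool \<times> (btree \<times> btree) list"
    assume I: "?I p st"
    show "st = ?r p" if "\<not> snd st \<noteq> []"
      using I that by (cases st) auto
    \<comment> \<open>The excess over the input is 2 for the list, at most 3 for the flag and 1 for
      the pair.\<close>
    show "size_of st \<le> size_of p + 6"
      using I size_of_bool_le[of "fst st"] by (cases st) auto
    assume ne: "snd st \<noteq> []"
    then obtain fl a b r where st: "st = (fl, (a, b) # r)"
      by (cases st; cases "snd st") auto
    show "?I p (tree_eq_step st)"
      using I unfolding st by (cases a; cases b) (auto simp: tree_eq_step_def size_of_def)
    show "?\<mu> (tree_eq_step st) < ?\<mu> st"
      unfolding st by (cases a; cases b) (auto simp: tree_eq_step_def)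
  next
    show "poly_bounded (\<lambda>p :: btree \<times> btree. size_of p + 6)" by auto
    show "?\<mu> (True, [p]) \<le> size_of p" for p :: "btree \<times> btree"
      by (cases p) (simp add: size_of_def)
  qed auto
  from polytime_fst[OF this] show ?thesis by simp
qed

text \<open>Encodings are injective, so one comparison of trees settles equality for every
  type.\<close>

lemma polytime_eq [polytime_intros]:
  assumes "polytime f" "polytime g"
  shows "polytime (\<lambda>x. f x = g x)"
proof -
  have enc: "polytime (enc :: 'b \<Rightarrow> btree)" by (rule polytime_recode) simp
  from polytime_comp[OF polytime_tree_eq polytime_Pair[OF polytime_comp[OF enc assms(1)] polytime_comp[OF enc assms(2)]]]
  show ?thesis by simp
qed

subsection \<open>Lists\<close>

lemma length_le_size: "length xs \<le> size_of xs"
  by (induction xs) auto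

lemma size_of_elem_le: "a \<in> set xs \<Longrightarrow> size_of a \<le> size_of xs"
  by (induction xs) auto

lemma size_of_append: "size_of (xs @ ys) + 1 = size_of xs + size_of ys"
  by (induction xs) auto

lemma size_of_filter_le: "size_of (filter P xs) \<le> size_of xs"
  by (induction xs) auto

lemma size_of_list_le:
  assumes "\<And>a. a \<in> set xs \<Longrightarrow> size_of a \<le> B" "length xs \<le> n"
  shows "size_of xs \<le> 1 + n * (1 + B)"
proof -
  have "size_of xs \<le> 1 + length xs * (1 + B)"
    using assms(1) by (induction xs) force+
  also have "\<dots> \<le> 1 + n * (1 + B)" using assms(2) by (intro add_left_mono mult_le_mono1)
  finally show ?thesis .
qed

text \<open>There is one round per list element; what has to be controlled is the growth of the
  accumulator. A bound is demanded only for the values that occur, those after prefixes of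
  \<open>xs x\<close>. The state carries \<open>x\<close> along because the step may use it.\<close>

lemma polytime_fold_prefix:
  fixes f :: "'x::encodable \<Rightarrow> 'a::encodable \<Rightarrow> 'b::encodable \<Rightarrow> 'b"
  assumes xs: "polytime xs" and b: "polytime b"
    and f: "polytime (\<lambda>p. f (fst p) (fst (snd p)) (snd (snd p)))"
    and S: "poly_bounded S" "\<And>x ys zs. xs x = ys @ zs \<Longrightarrow> size_of (fold (f x) ys (b x)) \<le> S x"
  shows "polytime (\<lambda>x. fold (f x) (xs x) (b x))"
proof -
  let ?I = "\<lambda>x st. fst st = x \<and>
    (\<exists>ys. xs x = ys @ fst (snd st) \<and> snd (snd st) = fold (f x) ys (b x))"
  let ?r = "\<lambda>x. (x, [] :: 'a list, fold (f x) (xs x) (b x))"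
  have "polytime ?r"
  proof (rule polytime_while[where i = "\<lambda>x. (x, xs x, b x)" and b = "\<lambda>st. fst (snd st) \<noteq> []" and
        f = "\<lambda>st. (fst st, tl (fst (snd st)), f (fst st) (hd (fst (snd st))) (snd (snd st)))" and
        I = ?I and \<mu> = "\<lambda>st. length (fst (snd st))" and K = "\<lambda>x. size_of (xs x)" and
        S = "\<lambda>x. 2 + size_of x + size_of (xs x) + S x"])
    show "polytime (\<lambda>st. (fst st, tl (fst (snd st)), f (fst st) (hd (fst (snd st))) (snd (snd st))))"
      using polytime_comp[OF f, of "\<lambda>st. (fst st, hd (fst (snd st)), snd (snd st))"]
      by (intro polytime_intros) (simp add: polytime_intros)
    show "poly_bounded (\<lambda>x. 2 + size_of x + size_of (xs x) + S x)"
      using S(1) polytime_size[OF xs] by (intro poly_bounded_add poly_bounded_const poly_bounded_size)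
    show "poly_bounded (\<lambda>x. size_of (xs x))" by (rule polytime_size[OF xs])
    fix x and st :: "'x \<times> 'a list \<times> 'b"
    assume I: "?I x st"
    obtain rest acc where st: "st = (x, rest, acc)" using I by (cases st) auto
    obtain ys where ys: "xs x = ys @ rest" "acc = fold (f x) ys (b x)" using I unfolding st by auto
    have "size_of rest \<le> size_of (xs x)"
      using size_of_append[of ys rest] size_of_pos[of ys] unfolding ys(1) by linarith
    then show "size_of st \<le> 2 + size_of x + size_of (xs x) + S x"
      using S(2)[OF ys(1)] ys(2) unfolding st by simp
    show "st = ?r x" if "\<not> fst (snd st) \<noteq> []"
      using that ys unfolding st by simp
    assume "fst (snd st) \<noteq> []"
    then obtain a as where as: "rest = a # as" unfolding st by (cases rest) auto
    show "?I x (fst st, tl (fst (snd st)), f (fst st) (hd (fst (snd st))) (snd (snd st)))"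
      using ys unfolding st as by (auto intro!: exI[of _ "ys @ [a]"])
    show "length (fst (snd (fst st, tl (fst (snd st)), f (fst st) (hd (fst (snd st))) (snd (snd st)))))
      < length (fst (snd st))"
      unfolding st as by simp
  qed (auto intro!: polytime_intros xs b length_le_size)
  from polytime_snd[OF polytime_snd[OF this]] show ?thesis by simp
qed

lemma polytime_fold_invariant:
  fixes f :: "'x::encodable \<Rightarrow> 'a::encodable \<Rightarrow> 'b::encodable \<Rightarrow> 'b"
  assumes "polytime xs" "polytime b" "polytime (\<lambda>p. f (fst p) (fst (snd p)) (snd (snd p)))"
    and "\<And>x. I x (b x)" and step: "\<And>x a acc. I x acc \<Longrightarrow> I x (f x a acc)"
    and "polytime g" and size: "\<And>x acc. I x acc \<Longrightarrow> size_of acc \<le> size_of (g x)"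
  shows "polytime (\<lambda>x. fold (f x) (xs x) (b x))"
  using assms(1-3)
proof (rule polytime_fold_prefix[OF _ _ _ polytime_size[OF assms(6)]])
  fix x and ys zs :: "'a list"
  have "I x (fold (f x) ys acc)" if "I x acc" for acc
    using that by (induction ys arbitrary: acc) (auto intro: step)
  then show "size_of (fold (f x) ys (b x)) \<le> size_of (g x)"
    using assms(4) size by blast
qed

text \<open>Growth per step must not depend on the accumulator: adding a polynomial in
  \<open>(x, a)\<close> once per element stays polynomial, whereas repeated doubling would
  not.\<close>

lemma polytime_fold_additive:
  fixes f :: "'x::encodable \<Rightarrow> 'a::encodable \<Rightarrow> 'b::encodable \<Rightarrow> 'b"
  assumes xs: "polytime xs" and b: "polytime b"
    and f: "polytime (\<lambda>p. f (fst p) (fst (snd p)) (snd (snd p)))"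
    and T: "poly_bounded T" and add: "\<And>x a acc. size_of (f x a acc) \<le> size_of acc + T (x, a)"
  shows "polytime (\<lambda>x. fold (f x) (xs x) (b x))"
proof -
  obtain d where d: "\<And>p. T p \<le> (size_of p + 1) ^ d"
    using T unfolding poly_bounded_def by blast
  \<comment> \<open>The base \<open>2 + size_of x + size_of (xs x)\<close> dominates
    \<open>size_of (x, a) + 1\<close> for each \<open>a\<close> in the list.\<close>
  let ?S = "\<lambda>x. size_of (b x) + size_of (xs x) * (2 + size_of x + size_of (xs x)) ^ d"
  show ?thesis
  proof (rule polytime_fold_prefix[OF xs b f])
    show "poly_bounded ?S"
      using polytime_size[OF xs] polytime_size[OF b]
      by (intro poly_bounded_add poly_bounded_mult poly_bounded_power poly_bounded_const poly_bounded_size)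
    fix x ys zs assume eq: "xs x = ys @ zs"
    have "size_of (fold (f x) us acc) \<le> size_of acc + length us * (2 + size_of x + size_of (xs x)) ^ d"
      if "set us \<subseteq> set (xs x)" for us acc
      using that
    proof (induction us arbitrary: acc)
      case (Cons a us)
      have "T (x, a) \<le> (size_of (x, a) + 1) ^ d" by (rule d)
      also have "\<dots> \<le> (2 + size_of x + size_of (xs x)) ^ d"
        using size_of_elem_le[of a "xs x"] Cons.prems by (intro power_mono) auto
      finally show ?case using add[of x a acc] Cons.IH[of "f x a acc"] Cons.prems by simp
    qed simp
    from this[of ys "b x"] have "size_of (fold (f x) ys (b x)) \<le>
        size_of (b x) + length ys * (2 + size_of x + size_of (xs x)) ^ d"
      by (simp add: eq)
    also have "\<dots> \<le> ?S x"
      using length_le_size[of "xs x"] unfolding eq by (intro add_left_mono mult_le_mono1) simp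
    finally show "size_of (fold (f x) ys (b x)) \<le> ?S x" .
  qed
qed

lemma fold_Cons_filter_map: "fold (\<lambda>a acc. if P a then f a # acc else acc) xs ys = rev (map f (filter P xs)) @ ys"
  by (induction xs arbitrary: ys) auto

text \<open>Folding \<open>Cons\<close> reverses, so the first list is reversed beforehand.\<close>

lemma polytime_append [polytime_intros]:
  assumes "polytime f" "polytime g"
  shows "polytime (\<lambda>x. f x @ g x)"
proof -
  have "polytime (\<lambda>x. fold Cons (f x) [])"
    by (rule polytime_fold_additive[where T = size_of])
      (auto intro!: polytime_intros assms)
  then have "polytime (\<lambda>x. fold Cons (fold Cons (f x) []) (g x))"
    by (rule polytime_fold_additive[where T = size_of])
      (auto intro!: polytime_intros assms)
  then show ?thesis by (simp add: fold_Cons_rev)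
qed

lemma polytime_rev [polytime_intros]:
  assumes "polytime f"
  shows "polytime (\<lambda>x. rev (f x))"
proof -
  have "polytime (\<lambda>x. fold Cons (f x) [])"
    by (rule polytime_fold_additive[where T = size_of])
      (auto intro!: polytime_intros assms)
  then show ?thesis by (simp add: fold_Cons_rev)
qed

lemma polytime_map [polytime_intros]:
  assumes "polytime (\<lambda>p. f (fst p) (snd p))" "polytime xs"
  shows "polytime (\<lambda>x. map (f x) (xs x))"
proof -
  have "polytime (\<lambda>x. fold (\<lambda>a acc. f x a # acc) (rev (xs x)) [])"
  proof (rule polytime_fold_additive[where T = "\<lambda>p. 1 + size_of (f (fst p) (snd p))"])
    show "poly_bounded (\<lambda>p. 1 + size_of (f (fst p) (snd p)))"
      using polytime_size[OF assms(1)] by (intro poly_bounded_add poly_bounded_const)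
    show "polytime (\<lambda>p. f (fst p) (fst (snd p)) # snd (snd p) :: 'c list)"
      using polytime_comp[OF assms(1), of "\<lambda>p. (fst p, fst (snd p))"]
      by (intro polytime_intros) (simp add: polytime_intros)
  qed (auto intro!: polytime_intros assms)
  then show ?thesis using fold_Cons_filter_map[of "\<lambda>_. True" "f _" "rev (xs _)" "[]"]
    by (simp add: rev_map)
qed

lemma polytime_filter [polytime_intros]:
  assumes "polytime (\<lambda>p. P (fst p) (snd p))" "polytime xs"
  shows "polytime (\<lambda>x. filter (P x) (xs x))"
proof -
  have "polytime (\<lambda>x. fold (\<lambda>a acc. if P x a then a # acc else acc) (rev (xs x)) [])"
  proof (rule polytime_fold_additive[where T = size_of])
    show "polytime (\<lambda>p. if P (fst p) (fst (snd p)) then fst (snd p) # snd (snd p) else snd (snd p))"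
      using polytime_comp[OF assms(1), of "\<lambda>p. (fst p, fst (snd p))"]
      by (intro polytime_intros) (simp add: polytime_intros)
  qed (auto intro!: polytime_intros assms)
  then show ?thesis using fold_Cons_filter_map[of "P _" "\<lambda>a. a" "rev (xs _)" "[]"]
    by (simp add: rev_filter)
qed

lemma polytime_concat [polytime_intros]:
  assumes "polytime xs"
  shows "polytime (\<lambda>x. concat (xs x))"
proof -
  have "size_of (a @ acc) \<le> size_of acc + size_of (x, a)" for x :: 'a and a acc :: "'b list"
    using size_of_append[of a acc] by simp
  then have "polytime (\<lambda>x. fold (@) (rev (xs x)) [])"
    by (intro polytime_fold_additive[where T = "\<lambda>p. size_of p"])
      (auto intro!: polytime_intros assms)
  moreover have "fold (@) (rev zs) ys = concat zs @ ys" for zs and ys :: "'b list"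
    by (induction zs arbitrary: ys rule: rev_induct) auto
  ultimately show ?thesis by simp
qed

lemma polytime_product [polytime_intros]:
  assumes "polytime xs" "polytime ys"
  shows "polytime (\<lambda>x. List.product (xs x) (ys x))"
  unfolding product_concat_map
  by (intro polytime_intros polytime_comp[OF assms(1)] polytime_comp[OF assms(2)])

lemma polytime_Ball [polytime_intros]:
  assumes "polytime (\<lambda>p. P (fst p) (snd p))" "polytime xs"
  shows "polytime (\<lambda>x. \<forall>a\<in>set (xs x). P x a)"
proof -
  have "polytime (\<lambda>x. filter (\<lambda>a. \<not> P x a) (xs x) = [])"
    by (intro polytime_intros assms)
  then show ?thesis by (simp add: filter_empty_conv)
qed

lemma polytime_Bex [polytime_intros]:
  assumes "polytime (\<lambda>p. P (fst p) (snd p))" "polytime xs"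
  shows "polytime (\<lambda>x. \<exists>a\<in>set (xs x). P x a)"
proof -
  have "polytime (\<lambda>x. filter (P x) (xs x) \<noteq> [])"
    by (intro polytime_intros assms)
  then show ?thesis by (simp add: filter_empty_conv)
qed

lemma polytime_member [polytime_intros]:
  assumes "polytime f" "polytime xs"
  shows "polytime (\<lambda>x. f x \<in> set (xs x))"
proof -
  have "polytime (\<lambda>x. \<exists>a\<in>set (xs x). a = f x)"
    by (intro polytime_intros assms polytime_comp[OF assms(1)])
  then show ?thesis by simp
qed

subsection \<open>Comparison of binary numerals\<close>

text \<open>Digit lists have the same trees as the numerals (\<open>enc_bits\<close>), which makes
  list recursion on numbers available at no cost.\<close>

fun bits :: "nat \<Rightarrow> bool list" where
  "bits n = (if n = 0 then [] else odd n # bits (n div 2))"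

declare bits.simps [simp del]

primrec of_bits :: "bool list \<Rightarrow> nat" where
  "of_bits [] = 0"
| "of_bits (b # bs) = of_bool b + 2 * of_bits bs"

lemma enc_bits: "enc (bits n) = enc n"
proof (induction n rule: bits.induct)
  case (1 n)
  then show ?case
    by (cases "n = 0") (auto simp: bits.simps[of n] bits.simps[of 0] enc_nat.simps[of 0] enc_nat_inst enc_nat.simps[of n] enc_bool_inst)
qed

lemma of_bits_bits: "of_bits (bits n) = n"
proof (induction n rule: bits.induct)
  case (1 n)
  then show ?case
    by (cases "n = 0") (auto simp: bits.simps[of n] bits.simps[of 0] elim: oddE)
qed

text \<open>Comparing from the least significant bit upwards, the last differing bit decides.\<close>

definition le_step :: "bool \<Rightarrow> bool list \<times> bool \<Rightarrow> bool list \<times> bool" where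
  "le_step a st =
     (tl (fst st), if a = (fst st \<noteq> [] \<and> hd (fst st)) then snd st else (fst st \<noteq> [] \<and> hd (fst st)))"

text \<open>Generalised over the verdict \<open>r\<close> on the lower digits, which survives only
  if the digits processed here agree. Missing digits of \<open>ys\<close> are read as zeros, and a
  nonzero rest of \<open>ys\<close> outweighs everything seen so far.\<close>

lemma fold_le_step:
  "(\<exists>b\<in>set (fst (fold le_step xs (ys, r))). b) \<or> snd (fold le_step xs (ys, r)) \<longleftrightarrow>
    of_bits xs < of_bits ys \<or> of_bits xs = of_bits ys \<and> r"
proof (induction xs arbitrary: ys r)
  case Nil
  have "(\<exists>b\<in>set ys. b) \<longleftrightarrow> 0 < of_bits ys" by (induction ys) auto
  then show ?case by auto
next
  case (Cons a xs)
  define b where "b = (ys \<noteq> [] \<and> hd ys)"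
  have ys: "of_bits ys = of_bool b + 2 * of_bits (tl ys)" by (cases ys) (auto simp: b_def)
  have "le_step a (ys, r) = (tl ys, if a = b then r else b)" 
    unfolding le_step_def b_def fst_conv snd_conv ..
  then show ?case unfolding ys by (cases a; cases b; cases r) (auto simp: Cons.IH)
qed

lemma polytime_le [polytime_intros]:
  assumes "polytime f" "polytime g"
  shows "polytime (\<lambda>x. f x \<le> (g x :: nat))"
proof -
  have bits: "polytime bits" by (rule polytime_recode) (rule enc_bits)
  \<comment> \<open>Starting from \<open>True\<close> makes equality count as
    \<open>\<le>\<close>.\<close>
  have "polytime (\<lambda>x. fold le_step (bits (f x)) (bits (g x), True))"
  proof (rule polytime_fold_invariant[where I = "\<lambda>x acc. size_of (fst acc) \<le> size_of (bits (g x))"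
        and g = "\<lambda>x. (bits (g x), True)"])
    show "polytime (\<lambda>p :: 'a \<times> bool \<times> bool list \<times> bool. le_step (fst (snd p)) (snd (snd p)))"
      unfolding le_step_def by (intro polytime_intros)
    show "size_of (fst (le_step a acc)) \<le> size_of (bits (g x))"
      if "size_of (fst acc) \<le> size_of (bits (g x))" for x a acc
      using that by (cases "fst acc") (auto simp: le_step_def)
    show "size_of acc \<le> size_of (bits (g x), True)"
      if "size_of (fst acc) \<le> size_of (bits (g x))" for x and acc :: "bool list \<times> bool"
      using that size_of_bool_le[of "snd acc"] by (cases acc) (simp add: size_of_def[of True])
  qed (auto intro!: polytime_intros polytime_comp[OF bits] assms)
  then have "polytime (\<lambda>x. (\<exists>b\<in>set (fst (fold le_step (bits (f x)) (bits (g x), True))). b) \<or>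
      snd (fold le_step (bits (f x)) (bits (g x), True)))"
    by (intro polytime_intros)
  then show ?thesis unfolding fold_le_step of_bits_bits by (simp add: order_le_less)
qed

section \<open>Unit flows\<close>

definition entering :: "('n \<times> 'n) set \<Rightarrow> 'n set \<Rightarrow> ('n \<times> 'n) set" where
  "entering E X = {e \<in> E. fst e \<notin> X \<and> snd e \<in> X}"

lemma finite_entering [simp]: "finite E \<Longrightarrow> finite (entering E X)"
  by (simp add: entering_def)

definition net_out :: "('n \<times> 'n) set \<Rightarrow> 'n \<Rightarrow> int" where
  "net_out F x = (\<Sum>e\<in>F. of_bool (fst e = x) - of_bool (snd e = x))"

text \<open>Arcs inside \<open>Y\<close> cancel in the sum, so only those crossing its boundary
  remain.\<close>

lemma sum_net_out:
  assumes "finite F" "finite Y"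
  shows "(\<Sum>x\<in>Y. net_out F x) = int (card {e \<in> F. fst e \<in> Y \<and> snd e \<notin> Y}) - int (card (entering F Y))"
proof -
  have "(\<Sum>x\<in>Y. net_out F x) = (\<Sum>e\<in>F. \<Sum>x\<in>Y. of_bool (fst e = x) - of_bool (snd e = x))"
    unfolding net_out_def by (rule sum.swap)
  also have "\<dots> = (\<Sum>e\<in>F. of_bool (fst e \<in> Y) - of_bool (snd e \<in> Y))"
    using assms(2) by (intro sum.cong) (auto simp: sum_subtractf of_bool_def)
  also have "\<dots> = (\<Sum>e\<in>F. of_bool (fst e \<in> Y \<and> snd e \<notin> Y) - of_bool (fst e \<notin> Y \<and> snd e \<in> Y))"
    by (intro sum.cong) auto
  also have "\<dots> = int (card {e \<in> F. fst e \<in> Y \<and> snd e \<notin> Y}) - int (card (entering F Y))"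
    using assms(1) by (simp add: sum_subtractf entering_def Int_def)
  finally show ?thesis .
qed

definition residual :: "('n \<times> 'n) set \<Rightarrow> ('n \<times> 'n) set \<Rightarrow> ('n \<times> 'n) set" where
  "residual E F = {(x, y). (x, y) \<in> E \<and> (x, y) \<notin> F \<or> (y, x) \<in> F}"

definition push :: "('n \<times> 'n) set \<Rightarrow> 'n \<Rightarrow> 'n \<Rightarrow> ('n \<times> 'n) set" where
  "push F x y = (if (y, x) \<in> F then F - {(y, x)} else insert (x, y) F)"

lemma net_out_push:
  assumes "finite F" "(x, y) \<in> residual E F"
  shows "net_out (push F x y) z = net_out F z + of_bool (x = z) - of_bool (y = z)"
  using assms by (auto simp: push_def net_out_def residual_def sum_diff1)

text \<open>A push changes the status of a single arc, and \<open>x\<close> is one of its endpoints.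
  Hence a search that has discarded \<open>x\<close> may continue as if nothing had been
  pushed.\<close>

lemma residual_push: "a \<noteq> x \<Longrightarrow> b \<noteq> x \<Longrightarrow> (a, b) \<in> residual E (push F x y) \<longleftrightarrow> (a, b) \<in> residual E F"
  by (auto simp: residual_def push_def)

text \<open>Cut the path at its last visit to \<open>x\<close>; the remainder avoids
  \<open>x\<close>.\<close>

lemma rtrancl_leave:
  assumes "(x, t) \<in> r\<^sup>*" "x \<noteq> t"
  shows "\<exists>y. y \<noteq> x \<and> (x, y) \<in> r \<and> (y, t) \<in> (r \<inter> (- {x}) \<times> (- {x}))\<^sup>*"
  using assms
proof (induction rule: rtrancl_induct)
  case (step t' t)
  show ?case
  proof (cases "x = t'")
    case True
    then show ?thesis using step by (intro exI[of _ t]) auto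
  next
    case False
    then obtain y where y: "y \<noteq> x" "(x, y) \<in> r" "(y, t') \<in> (r \<inter> (- {x}) \<times> (- {x}))\<^sup>*"
      using step by blast
    have "(t', t) \<in> r \<inter> (- {x}) \<times> (- {x})" using step False by auto
    then show ?thesis using y by (meson rtrancl.rtrancl_into_rtrancl)
  qed
qed simp

subsection \<open>Reachability\<close>

text \<open>Adding the arcs one at a time as in \<open>rtrancl_insert\<close> makes a single pass sufficient.\<close>

definition rtc :: "'n list \<Rightarrow> ('n \<times> 'n) list \<Rightarrow> ('n \<times> 'n) list" where
  "rtc W es = fold (\<lambda>e T. filter (\<lambda>p. p \<in> set T \<or> (fst p, fst e) \<in> set T \<and> (snd e, snd p) \<in> set T)
     (List.product W W)) es (filter (\<lambda>p. fst p = snd p) (List.product W W))"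

text \<open>The induction is generalised to the closure of an arbitrary relation \<open>r\<close>
  built so far. Confining the pairs to \<open>set W\<close> loses nothing, because the endpoints of
  each added arc lie there.\<close>

lemma set_rtc:
  assumes "set es \<subseteq> set W \<times> set W"
  shows "set (rtc W es) = (set es)\<^sup>* \<inter> set W \<times> set W"
proof -
  have fold: "set (fold (\<lambda>e T. filter (\<lambda>p. p \<in> set T \<or> (fst p, fst e) \<in> set T \<and> (snd e, snd p) \<in> set T)
     (List.product W W)) es T) = (r \<union> set es)\<^sup>* \<inter> set W \<times> set W"
    if "set T = r\<^sup>* \<inter> set W \<times> set W" for T r
    using assms that
  proof (induction es arbitrary: T r)
    case (Cons e es)
    obtain a b where e: "e = (a, b)" by (cases e)
    let ?T = "filter (\<lambda>p. p \<in> set T \<or> (fst p, fst e) \<in> set T \<and> (snd e, snd p) \<in> set T)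
      (List.product W W)"
    have "set ?T = (insert e r)\<^sup>* \<inter> set W \<times> set W"
      using Cons.prems unfolding e rtrancl_insert by auto
    from Cons.IH[OF _ this] Cons.prems show ?case by simp
  qed simp
  have "set (filter (\<lambda>p. fst p = snd p) (List.product W W)) = {}\<^sup>* \<inter> set W \<times> set W" by auto
  from fold[OF this] show ?thesis unfolding rtc_def by simp
qed

lemma polytime_rtc [polytime_intros]:
  assumes "polytime W" "polytime es"
  shows "polytime (\<lambda>x. rtc (W x) (es x))"
  unfolding rtc_def
  by (rule polytime_fold_invariant[where
        I = "\<lambda>x acc. size_of acc \<le> size_of (List.product (W x) (W x))" and
        g = "\<lambda>x. List.product (W x) (W x)"])
    (intro polytime_intros assms polytime_comp[OF assms(1)] size_of_filter_le | assumption)+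

definition residual_list :: "('n \<times> 'n) list \<Rightarrow> ('n \<times> 'n) list \<Rightarrow> 'n list \<Rightarrow> ('n \<times> 'n) list" where
  "residual_list E F U =
     filter (\<lambda>p. p \<in> set E \<and> p \<notin> set F \<or> (snd p, fst p) \<in> set F) (List.product U U)"

lemma set_residual_list: "set (residual_list E F U) = residual (set E) (set F) \<inter> set U \<times> set U"
  by (auto simp: residual_list_def residual_def)

lemma polytime_residual_list [polytime_intros]:
  assumes "polytime E" "polytime F" "polytime U"
  shows "polytime (\<lambda>x. residual_list (E x) (F x) (U x))"
  unfolding residual_list_def
  by (intro polytime_intros assms polytime_comp[OF assms(1)] polytime_comp[OF assms(2)])

definition reachable :: "('n \<times> 'n) list \<Rightarrow> ('n \<times> 'n) list \<Rightarrow> 'n list \<Rightarrow> 'n \<Rightarrow> 'n \<Rightarrow> bool" where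
  "reachable E F U x y \<longleftrightarrow> (x, y) \<in> set (rtc U (residual_list E F U))"

lemma reachable_iff:
  "reachable E F U x y \<longleftrightarrow> x \<in> set U \<and> y \<in> set U \<and>
     (x, y) \<in> (residual (set E) (set F) \<inter> set U \<times> set U)\<^sup>*"
  by (auto simp: reachable_def set_rtc set_residual_list)

lemma polytime_reachable [polytime_intros]:
  assumes "polytime E" "polytime F" "polytime U" "polytime a" "polytime b"
  shows "polytime (\<lambda>x. reachable (E x) (F x) (U x) (a x) (b x))"
  unfolding reachable_def by (intro polytime_intros assms)

subsection \<open>Augmentation\<close>

definition push_list :: "('n \<times> 'n) list \<Rightarrow> ('n \<times> 'n) list \<Rightarrow> 'n \<Rightarrow> 'n \<Rightarrow> ('n \<times> 'n) list" where
  "push_list E F x y =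
     filter (\<lambda>e. if (y, x) \<in> set F then e \<in> set F \<and> e \<noteq> (y, x) else e \<in> set F \<or> e = (x, y)) E"

lemma set_push_list:
  "set F \<subseteq> set E \<Longrightarrow> (x, y) \<in> residual (set E) (set F) \<Longrightarrow> set (push_list E F x y) = push (set F) x y"
  by (auto simp: push_list_def push_def residual_def)

lemma polytime_push_list [polytime_intros]:
  assumes "polytime E" "polytime F" "polytime a" "polytime b"
  shows "polytime (\<lambda>x. push_list (E x) (F x) (a x) (b x))"
  unfolding push_list_def
  by (intro polytime_intros assms polytime_comp[OF assms(2)] polytime_comp[OF assms(3)]
      polytime_comp[OF assms(4)])

text \<open>Requiring that \<open>t\<close> stay reachable once \<open>x\<close> is deleted keeps
  the unit out of dead ends, so no path has to be stored.\<close>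

definition next_nodes :: "('n \<times> 'n) list \<Rightarrow> 'n \<Rightarrow> ('n \<times> 'n) list \<Rightarrow> 'n list \<Rightarrow> 'n \<Rightarrow> 'n list" where
  "next_nodes E t F U x =
     filter (\<lambda>y. (x, y) \<in> set (residual_list E F U) \<and> reachable E F (filter (\<lambda>y. y \<noteq> x) U) y t)
       (filter (\<lambda>y. y \<noteq> x) U)"

lemma polytime_next_nodes [polytime_intros]:
  assumes "polytime E" "polytime t" "polytime F" "polytime U" "polytime a"
  shows "polytime (\<lambda>x. next_nodes (E x) (t x) (F x) (U x) (a x))"
  unfolding next_nodes_def
  by (intro polytime_intros assms polytime_comp[OF assms(1)] polytime_comp[OF assms(2)]
      polytime_comp[OF assms(3)] polytime_comp[OF assms(4)] polytime_comp[OF assms(5)]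
      polytime_comp[OF assms(5), of "\<lambda>x. fst (fst x)"])

text \<open>A unit of flow is moved along one residual arc at a time. Its current position is the last
  component of the state; the second one lists the nodes that may still be visited, so the residual
  arcs between them are not affected by the moves already made.\<close>

definition advance :: "('n \<times> 'n) list \<Rightarrow> 'n \<Rightarrow> ('n \<times> 'n) list \<times> 'n list \<times> 'n \<Rightarrow>
    ('n \<times> 'n) list \<times> 'n list \<times> 'n" where
  "advance E t st =
     (case st of (F, U, x) \<Rightarrow>
       if x = t \<or> next_nodes E t F U x = [] then st
       else (push_list E F x (hd (next_nodes E t F U x)), filter (\<lambda>y. y \<noteq> x) U, hd (next_nodes E t F U x)))"

text \<open>\<open>W\<close> doubles as the clock: each move discards a node, so
  \<open>length W\<close> moves suffice.\<close>

definition augment :: "('n \<times> 'n) list \<Rightarrow> 'n list \<Rightarrow> ('n \<times> 'n) list \<Rightarrow> 'n \<Rightarrow> 'n \<Rightarrow> ('n \<times> 'n) list" where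
  "augment E W F s t = fst (fold (\<lambda>_. advance E t) W (F, W, s))"

lemma advance_correct:
  assumes F: "set F \<subseteq> set E" and r: "reachable E F U x t" and ne: "x \<noteq> t"
  obtains F' y where "advance E t (F, U, x) = (F', filter (\<lambda>y. y \<noteq> x) U, y)" "set F' \<subseteq> set E"
    "reachable E F' (filter (\<lambda>y. y \<noteq> x) U) y t"
    "\<And>z. net_out (set F') z = net_out (set F) z + of_bool (x = z) - of_bool (y = z)"
proof -
  let ?U = "filter (\<lambda>y. y \<noteq> x) U"
  let ?R = "residual (set E) (set F)"
  have xU: "x \<in> set U" "t \<in> set U" "(x, t) \<in> (?R \<inter> set U \<times> set U)\<^sup>*"
    using r by (auto simp: reachable_iff)
  \<comment> \<open>A path that leaves \<open>x\<close> for good shows that an admissible next node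
    exists.\<close>
  from rtrancl_leave[OF xU(3) ne] obtain y' where y': "y' \<noteq> x" "(x, y') \<in> ?R \<inter> set U \<times> set U"
    "(y', t) \<in> (?R \<inter> set U \<times> set U \<inter> (- {x}) \<times> (- {x}))\<^sup>*" by blast
  have sub: "?R \<inter> set U \<times> set U \<inter> (- {x}) \<times> (- {x}) = ?R \<inter> set ?U \<times> set ?U" by auto
  have "y' \<in> set (next_nodes E t F U x)"
    using y' xU(2) ne unfolding sub by (auto simp: next_nodes_def set_residual_list reachable_iff)
  then have nn: "next_nodes E t F U x \<noteq> []" by auto
  define y where "y = hd (next_nodes E t F U x)"
  have "y \<in> set (next_nodes E t F U x)" unfolding y_def using nn by (rule hd_in_set)
  then have y: "(x, y) \<in> ?R" "reachable E F ?U y t"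
    by (auto simp: next_nodes_def set_residual_list)
  define F' where "F' = push_list E F x y"
  have F': "set F' = push (set F) x y" unfolding F'_def using F y(1) by (rule set_push_list)
  show thesis
  proof (rule that)
    show "advance E t (F, U, x) = (F', ?U, y)"
      using ne nn by (simp add: advance_def F'_def y_def)
    show "set F' \<subseteq> set E" by (auto simp: F'_def push_list_def)
    have "residual (set E) (set F') \<inter> set ?U \<times> set ?U = ?R \<inter> set ?U \<times> set ?U"
      unfolding F' using residual_push by fastforce
    then show "reachable E F' ?U y t" using y(2) by (simp add: reachable_iff)
    show "net_out (set F') z = net_out (set F) z + of_bool (x = z) - of_bool (y = z)" for z
      unfolding F' by (rule net_out_push[OF _ y(1)]) simp
  qed
qed

text \<open>A path through the nodes of \<open>U\<close> has at most \<open>card (set U) - 1\<close>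
  arcs, hence the \<open>Suc\<close>; after arrival at \<open>t\<close> further rounds change
  nothing.\<close>

lemma fold_advance:
  assumes "set F \<subseteq> set E" "reachable E F U x t" "card (set U) \<le> Suc (length ws)"
  shows "set (fst (fold (\<lambda>_. advance E t) ws (F, U, x))) \<subseteq> set E \<and>
    net_out (set (fst (fold (\<lambda>_. advance E t) ws (F, U, x)))) z =
      net_out (set F) z + of_bool (x = z) - of_bool (t = z)"
  using assms
proof (induction ws arbitrary: F U x)
  case Nil
  then have "x \<in> set U" "t \<in> set U" by (auto simp: reachable_iff)
  then have "x = t" using Nil.prems(3) card_le_Suc0_iff_eq[of "set U"] by auto
  then show ?case using Nil by simp
next
  case (Cons w ws)
  show ?case
  proof (cases "x = t")
    case True
    have "fold (\<lambda>_. advance E t) us (F, U, t) = (F, U, t)" for us :: "'b list"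
      by (induction us) (auto simp: advance_def)
    from this[of "w # ws"] show ?thesis using Cons.prems(1) unfolding True by (simp del: fold_simps)
  next
    case False
    obtain F' y where 1: "advance E t (F, U, x) = (F', filter (\<lambda>y. y \<noteq> x) U, y)" "set F' \<subseteq> set E"
      "reachable E F' (filter (\<lambda>y. y \<noteq> x) U) y t"
      "\<And>z. net_out (set F') z = net_out (set F) z + of_bool (x = z) - of_bool (y = z)"
      using advance_correct[OF Cons.prems(1,2) False] by blast
    have "x \<in> set U" using Cons.prems(2) by (simp add: reachable_iff)
    moreover have "set (filter (\<lambda>y. y \<noteq> x) U) = set U - {x}" by auto
    ultimately have "card (set (filter (\<lambda>y. y \<noteq> x) U)) \<le> Suc (length ws)"
      using Cons.prems(3) by simp
    from Cons.IH[OF 1(2,3) this] show ?thesis using 1(1) 1(4)[of z] by simp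
  qed
qed

lemma augment_correct:
  assumes "set F \<subseteq> set E" "reachable E F W s t"
  shows "set (augment E W F s t) \<subseteq> set E"
    and "net_out (set (augment E W F s t)) z = net_out (set F) z + of_bool (s = z) - of_bool (t = z)"
  using fold_advance[OF assms, of W z] card_length[of W] unfolding augment_def by auto

lemma polytime_augment [polytime_intros]:
  assumes "polytime E" "polytime W" "polytime F" "polytime s" "polytime t"
  shows "polytime (\<lambda>x. augment (E x) (W x) (F x) (s x) (t x))"
proof -
  \<comment> \<open>The initial flow is arbitrary, while after a push the flow is a sublist of
    \<open>E x\<close>; the sum of the sizes covers both.\<close>
  let ?I = "\<lambda>x st. size_of (fst st) \<le> size_of (E x) + size_of (F x) \<and>
    size_of (fst (snd st)) \<le> size_of (W x) \<and>
    set (fst (snd st)) \<subseteq> set (W x) \<and> snd (snd st) \<in> set (s x # W x)"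
  have "polytime (\<lambda>x. fold (\<lambda>_. advance (E x) (t x)) (W x) (F x, W x, s x))"
  proof (rule polytime_fold_invariant[where I = ?I and
        g = "\<lambda>x. ((E x, F x), W x, s x # W x)"])
    show "polytime (\<lambda>p :: 'a \<times> 'b \<times> ('b \<times> 'b) list \<times> 'b list \<times> 'b.
        advance (E (fst p)) (t (fst p)) (snd (snd p)))"
      unfolding advance_def
      by (intro polytime_intros polytime_comp[OF assms(1)] polytime_comp[OF assms(5)])
    fix x and w :: 'b and st :: "('b \<times> 'b) list \<times> 'b list \<times> 'b" assume I: "?I x st"
    obtain F0 U y where st: "st = (F0, U, y)" by (cases st)
    show "size_of st \<le> size_of ((E x, F x), W x, s x # W x)"
      using I size_of_elem_le[of y "s x # W x"] unfolding st by auto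
    let ?N = "next_nodes (E x) (t x) F0 U y"
    have "?N \<noteq> [] \<Longrightarrow> hd ?N \<in> set U" using hd_in_set[of ?N] by (auto simp: next_nodes_def)
    moreover have "size_of (push_list (E x) F0 y (hd ?N)) \<le> size_of (E x)"
      unfolding push_list_def by (rule size_of_filter_le)
    moreover have "size_of (filter (\<lambda>z. z \<noteq> y) U) \<le> size_of U" by (rule size_of_filter_le)
    ultimately show "?I x (advance (E x) (t x) st)"
      using I unfolding st by (auto simp: advance_def)
  qed (auto intro!: polytime_intros assms)
  then show ?thesis unfolding augment_def by (rule polytime_fst)
qed

definition saturate :: "('n \<times> 'n) list \<Rightarrow> 'n list \<Rightarrow> 'n \<Rightarrow> 'n list \<Rightarrow> ('n \<times> 'n) list \<times> bool" where
  "saturate E W t ss =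
     fold (\<lambda>s st. if snd st \<and> reachable E (fst st) W s t then (augment E W (fst st) s t, True)
       else (fst st, False)) ss ([], True)"

text \<open>The max-flow min-cut argument. If \<open>s\<close> cannot reach \<open>t\<close>, let
  \<open>Y\<close> consist of the nodes it cannot reach in the residual graph. The flow uses all
  arcs entering \<open>Y\<close> and none leaving it, so as many arcs enter \<open>Y\<close> as
  there are earlier sources outside, and \<open>s\<close> is one source more.\<close>

lemma saturate_correct:
  assumes E: "set E \<subseteq> set W \<times> set W" and t: "t \<in> set W" and ss: "set ss \<subseteq> set W" "distinct ss"
  shows "if snd (saturate E W t ss)
    then set (fst (saturate E W t ss)) \<subseteq> set E \<and>
      (\<forall>z. net_out (set (fst (saturate E W t ss))) z = of_bool (z \<in> set ss) - int (length ss) * of_bool (z = t))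
    else \<exists>Y\<subseteq>set W. t \<in> Y \<and> card (entering (set E) Y) < card (set ss - Y)"
  using ss
proof (induction ss rule: rev_induct)
  case Nil
  then show ?case by (simp add: saturate_def net_out_def)
next
  case (snoc s ss)
  obtain F ok where st: "saturate E W t ss = (F, ok)" by (cases "saturate E W t ss")
  have snoc_eq: "saturate E W t (ss @ [s]) =
    (if ok \<and> reachable E F W s t then (augment E W F s t, True) else (F, False))"
    using st unfolding saturate_def by simp
  have s: "s \<notin> set ss" "s \<in> set W" "distinct ss" "set ss \<subseteq> set W" using snoc.prems by auto
  note IH = snoc.IH[OF s(4,3), unfolded st fst_conv snd_conv]
  show ?case
  proof (cases ok)
    case False
    then obtain Y where Y: "Y \<subseteq> set W" "t \<in> Y" "card (entering (set E) Y) < card (set ss - Y)"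
      using IH by auto
    have "card (set ss - Y) \<le> card (set (ss @ [s]) - Y)" by (rule card_mono) auto
    then have "card (entering (set E) Y) < card (set (ss @ [s]) - Y)" using Y(3) by linarith
    then show ?thesis using Y(1,2) False unfolding snoc_eq by (simp del: set_append) blast
  next
    case True
    have F: "set F \<subseteq> set E"
      "\<And>z. net_out (set F) z = of_bool (z \<in> set ss) - int (length ss) * of_bool (z = t)"
      using IH True by simp_all
    show ?thesis
    proof (cases "reachable E F W s t")
      case r: True
      have "net_out (set (augment E W F s t)) z =
          of_bool (z \<in> set (ss @ [s])) - int (length (ss @ [s])) * of_bool (z = t)" for z
        using augment_correct(2)[OF F(1) r, of z] F(2)[of z] s(1) by (cases "z = t"; cases "z = s") auto
      then show ?thesis
        unfolding snoc_eq using augment_correct(1)[OF F(1) r] True r by (simp del: set_append length_append)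
    next
      case False
      define Y where "Y = {y \<in> set W. (s, y) \<notin> (residual (set E) (set F) \<inter> set W \<times> set W)\<^sup>*}"
      have Y: "Y \<subseteq> set W" "t \<in> Y" "s \<notin> Y"
        using False s(2) t by (auto simp: Y_def reachable_iff)
      have closed: "y \<notin> Y" if "x \<in> set W" "x \<notin> Y" "(x, y) \<in> residual (set E) (set F)" "y \<in> set W" for x y
        using that unfolding Y_def by (auto intro: rtrancl_into_rtrancl)
      \<comment> \<open>A flow arc leaving \<open>Y\<close> would give a residual arc back into
        it.\<close>
      have "{e \<in> set F. fst e \<in> Y \<and> snd e \<notin> Y} = {}"
      proof -
        have False if "(y, x) \<in> set F" "y \<in> Y" "x \<notin> Y" for x y
          using closed[of x y] that F(1) E by (auto simp: residual_def)
        then show ?thesis by force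
      qed
      moreover have "entering (set F) Y = entering (set E) Y"
      proof -
        have "(x, y) \<in> set F" if "(x, y) \<in> set E" "x \<notin> Y" "y \<in> Y" for x y
          using closed[of x y] that E by (auto simp: residual_def)
        then show ?thesis using F(1) unfolding entering_def by force
      qed
      ultimately have "(\<Sum>z\<in>Y. net_out (set F) z) = - int (card (entering (set E) Y))"
        using sum_net_out[of "set F" Y] finite_subset[OF Y(1)] by simp
      moreover have "(\<Sum>z\<in>Y. net_out (set F) z) = int (card (set ss \<inter> Y)) - int (length ss)"
        unfolding F(2) using finite_subset[OF Y(1)] Y(2)
        by (simp add: sum_subtractf Int_commute flip: sum_distrib_left)
      moreover have "int (length ss) = int (card (set ss \<inter> Y)) + int (card (set ss - Y))"
        using card_Int_Diff[of "set ss" Y] distinct_card[OF s(3)] by simp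
      ultimately have "card (entering (set E) Y) = card (set ss - Y)" by simp
      also have "\<dots> < card (set (ss @ [s]) - Y)"
        using s(1) Y(3) by (intro psubset_card_mono) auto
      finally show ?thesis using Y(1,2) False unfolding snoc_eq by (simp del: set_append) blast
    qed
  qed
qed

definition feasible :: "('n \<times> 'n) list \<Rightarrow> 'n list \<Rightarrow> 'n \<Rightarrow> 'n list \<Rightarrow> bool" where
  "feasible E W t ss \<longleftrightarrow> snd (saturate E W t ss)"

text \<open>Failure exhibits a violated cut. Success exhibits a flow whose units all end at
  \<open>t\<close>, inside \<open>Y\<close>; summing the net outflow over \<open>Y\<close> shows
  that the sources outside \<open>Y\<close> need as many flow arcs entering it.\<close>

theorem feasible_iff:
  assumes "set E \<subseteq> set W \<times> set W" "t \<in> set W" "set ss \<subseteq> set W" "distinct ss"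
  shows "feasible E W t ss \<longleftrightarrow>
    (\<forall>Y\<subseteq>set W. t \<in> Y \<longrightarrow> card (set ss - Y) \<le> card (entering (set E) Y))"
proof (cases "feasible E W t ss")
  case False
  then show ?thesis using saturate_correct[OF assms] by (auto simp: feasible_def not_le)
next
  case True
  define F where "F = set (fst (saturate E W t ss))"
  have F: "F \<subseteq> set E" "\<And>z. net_out F z = of_bool (z \<in> set ss) - int (length ss) * of_bool (z = t)"
    using saturate_correct[OF assms] True by (auto simp: feasible_def F_def)
  have fin: "finite F" by (simp add: F_def)
  have "card (set ss - Y) \<le> card (entering (set E) Y)" if Y: "Y \<subseteq> set W" "t \<in> Y" for Y
  proof -
    have "(\<Sum>z\<in>Y. net_out F z) = int (card (set ss \<inter> Y)) - int (length ss)"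
      unfolding F(2) using finite_subset[OF Y(1)] Y(2)
      by (simp add: sum_subtractf Int_commute flip: sum_distrib_left)
    also have "int (length ss) = int (card (set ss \<inter> Y)) + int (card (set ss - Y))"
      using card_Int_Diff[of "set ss" Y] distinct_card[OF assms(4)] by simp
    finally have "int (card (set ss - Y)) \<le> int (card (entering F Y))"
      using sum_net_out[OF fin, of Y] finite_subset[OF Y(1)] by simp
    also have "card (entering F Y) \<le> card (entering (set E) Y)"
      using F(1) by (intro card_mono) (auto simp: entering_def)
    finally show ?thesis by simp
  qed
  then show ?thesis using True by blast
qed

lemma polytime_feasible [polytime_intros]:
  assumes "polytime E" "polytime W" "polytime t" "polytime ss"
  shows "polytime (\<lambda>x. feasible (E x) (W x) (t x) (ss x))"
proof -
  have "polytime (\<lambda>x. saturate (E x) (W x) (t x) (ss x))"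
    unfolding saturate_def
  proof (rule polytime_fold_invariant[where
        I = "\<lambda>x st. size_of (fst st) \<le> size_of (E x)" and g = "\<lambda>x. (E x, True)"])
    fix x s and st :: "('b \<times> 'b) list \<times> bool" assume I: "size_of (fst st) \<le> size_of (E x)"
    show "size_of st \<le> size_of (E x, True)"
      using I size_of_bool_le[of "snd st"] by (cases st) (simp add: size_of_def[of True])
    \<comment> \<open>Here the flow starts empty and stays within \<open>size_of (E x)\<close>. The
      bound used for a single \<open>augment\<close> adds two sizes and would grow with each
      source.\<close>
    have "size_of (fst st') \<le> size_of (E x)"
      if "st' = fold (\<lambda>_. advance (E x) (t x)) us st0" "size_of (fst st0) \<le> size_of (E x)"
      for us :: "'b list" and st0 st'
      using that
    proof (induction us arbitrary: st0)
      case (Cons u us)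
      have "size_of (fst (advance (E x) (t x) st0)) \<le> size_of (E x)"
        using Cons.prems(2) by (cases st0) (auto simp: advance_def push_list_def size_of_filter_le)
      then show ?case using Cons by simp
    qed simp
    then show "size_of (fst (if snd st \<and> reachable (E x) (fst st) (W x) s (t x)
        then (augment (E x) (W x) (fst st) s (t x), True) else (fst st, False))) \<le> size_of (E x)"
      using I by (auto simp: augment_def)
  qed (auto intro!: polytime_intros polytime_comp[OF assms(1)] polytime_comp[OF assms(2)]
      polytime_comp[OF assms(3)] assms simp: Suc_le_eq)
  then show ?thesis unfolding feasible_def by (rule polytime_snd)
qed

section \<open>Edmonds' disjoint branchings\<close>

definition missed :: "'i set \<Rightarrow> ('i \<Rightarrow> 'n set) \<Rightarrow> 'n set \<Rightarrow> 'i set" where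
  "missed I R X = {i \<in> I. R i \<inter> X = {}}"

definition root_condition :: "'n set \<Rightarrow> ('n \<times> 'n) set \<Rightarrow> 'i set \<Rightarrow> ('i \<Rightarrow> 'n set) \<Rightarrow> bool" where
  "root_condition V A I R \<longleftrightarrow> (\<forall>X\<subseteq>V. X \<noteq> {} \<longrightarrow> card (missed I R X) \<le> card (entering A X))"

lemma card_eq_sum_of_bool: "finite S \<Longrightarrow> card {x \<in> S. P x} = (\<Sum>x\<in>S. of_bool (P x))"
  by (simp add: Int_def)

lemma entering_submodular:
  assumes "finite A"
  shows "card (entering A (X \<inter> Y)) + card (entering A (X \<union> Y)) \<le> card (entering A X) + card (entering A Y)"
  unfolding entering_def card_eq_sum_of_bool[OF assms] sum.distrib[symmetric]
  by (rule sum_mono) auto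

lemma missed_supermodular:
  assumes "finite I"
  shows "card (missed I R X) + card (missed I R Y) \<le> card (missed I R (X \<inter> Y)) + card (missed I R (X \<union> Y))"
  unfolding missed_def card_eq_sum_of_bool[OF assms] sum.distrib[symmetric]
  by (rule sum_mono) auto

text \<open>The index \<open>i\<close> counts for neither \<open>X\<close> nor \<open>Y\<close> but
  does count for the intersection, which makes the inequality strict.\<close>

lemma missed_supermodular_strict:
  assumes "finite I" "i \<in> I" "R i \<inter> X \<noteq> {}" "R i \<inter> Y \<noteq> {}" "R i \<inter> (X \<inter> Y) = {}"
  shows "card (missed I R X) + card (missed I R Y) < card (missed I R (X \<inter> Y)) + card (missed I R (X \<union> Y))"
  unfolding missed_def card_eq_sum_of_bool[OF assms(1)] sum.distrib[symmetric]
  by (rule sum_strict_mono_ex1) (use assms in \<open>auto intro!: bexI[of _ i]\<close>)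

text \<open>Lovasz's argument: an arc leaving \<open>R i\<close> inside an inclusion-minimal tight set that meets both
  \<open>R i\<close> and its complement can be moved to the \<open>i\<close>-th branching.\<close>

theorem root_condition_extend:
  assumes fin: "finite V" "finite I" and A: "A \<subseteq> V \<times> V" and i: "i \<in> I"
    and R: "R i \<subseteq> V" "R i \<noteq> V" and cond: "root_condition V A I R"
  obtains u v where "(u, v) \<in> A" "u \<in> R i" "v \<notin> R i"
    "root_condition V (A - {(u, v)}) I (R(i := insert v (R i)))"
proof -
  have finA: "finite A" by (rule finite_subset[OF A]) (simp add: fin)
  let ?d = "\<lambda>X. card (entering A X)" and ?p = "\<lambda>X. card (missed I R X)"
  have le: "?p X \<le> ?d X" if "X \<subseteq> V" "X \<noteq> {}" for X
    using cond that by (simp add: root_condition_def)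
  define crit where "crit X \<longleftrightarrow> X \<subseteq> V \<and> ?d X = ?p X \<and> R i \<inter> X \<noteq> {} \<and> X - R i \<noteq> {}" for X
  \<comment> \<open>No arc enters \<open>V\<close>, so the condition forces every root set to meet
    \<open>V\<close>; hence \<open>V\<close> is critical and a minimal critical set exists.\<close>
  have "entering A V = {}" using A by (auto simp: entering_def)
  moreover have "V \<noteq> {}" using R by auto
  ultimately have "?p V = 0" using le[of V] by simp
  then have "missed I R V = {}" using fin by (simp add: missed_def)
  then have "R i \<inter> V \<noteq> {}" using i by (auto simp: missed_def)
  then have "crit V" using R \<open>entering A V = {}\<close> \<open>?p V = 0\<close> by (auto simp: crit_def)
  moreover have "finite {X. crit X}"
    by (rule finite_subset[of _ "Pow V"]) (auto simp: crit_def fin(1))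
  ultimately obtain X where X: "crit X" and min: "\<And>Y. crit Y \<Longrightarrow> Y \<subseteq> X \<Longrightarrow> Y = X"
    using finite_has_minimal2[of "{X. crit X}" V] by auto
  have finm: "finite (missed I R Z)" for Z using fin by (simp add: missed_def)
  \<comment> \<open>The index \<open>i\<close> counts for \<open>X - R i\<close> but not for
    \<open>X\<close>, so more arcs enter \<open>X - R i\<close> than the tight set \<open>X\<close>.
    An arc that enters only the smaller set starts in \<open>X \<inter> R i\<close>.\<close>
  have "missed I R X \<subset> missed I R (X - R i)"
    using X i by (auto simp: crit_def missed_def)
  then have "?d X < ?p (X - R i)"
    using X psubset_card_mono[OF finm] unfolding crit_def by simp
  also have "\<dots> \<le> ?d (X - R i)" using X by (intro le) (auto simp: crit_def)
  finally have "\<not> entering A (X - R i) \<subseteq> entering A X"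
    using card_mono[of "entering A X" "entering A (X - R i)"] finA by auto
  then obtain u v where uv: "(u, v) \<in> A" "u \<in> X" "u \<in> R i" "v \<in> X" "v \<notin> R i"
    by (auto simp: entering_def)
  have "card (missed I (R(i := insert v (R i))) Y) \<le> card (entering (A - {(u, v)}) Y)"
    if Y: "Y \<subseteq> V" "Y \<noteq> {}" for Y
  proof -
    let ?R = "R(i := insert v (R i))"
    have sub: "missed I ?R Y \<subseteq> missed I R Y" by (auto simp: missed_def split: if_splits)
    show ?thesis
    proof (cases "v \<in> Y \<and> u \<notin> Y")
      case False
      then have "entering (A - {(u, v)}) Y = entering A Y" by (auto simp: entering_def)
      then show ?thesis using le[OF Y] card_mono[OF finm sub] by simp
    next
      case True
      then have e: "entering (A - {(u, v)}) Y = entering A Y - {(u, v)}" "(u, v) \<in> entering A Y"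
        using uv by (auto simp: entering_def)
      have d: "card (entering (A - {(u, v)}) Y) = ?d Y - 1" "?d Y > 0"
        unfolding e(1) using e(2) finA by (simp_all add: card_gt_0_iff) blast
      show ?thesis
      proof (cases "R i \<inter> Y = {}")
        case dis: True
        \<comment> \<open>\<open>Y\<close> loses an entering arc, but \<open>i\<close> no longer
          counts for it, since \<open>v\<close> has become a root.\<close>
        then have "missed I ?R Y \<subseteq> missed I R Y - {i}" "i \<in> missed I R Y"
          using True i by (auto simp: missed_def split: if_splits)
        then have "card (missed I ?R Y) \<le> ?p Y - 1"
          using card_mono[of "missed I R Y - {i}" "missed I ?R Y"] finm by simp
        then show ?thesis using d le[OF Y] by simp
      next
        case meets: False
        \<comment> \<open>Uncrossing: a tight \<open>Y\<close> would make
          \<open>X \<inter> Y\<close> tight, and strict supermodularity would make it meet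
          \<open>R i\<close>. As it contains \<open>v\<close> but not \<open>u\<close>, it would be
          a critical set properly inside the minimal \<open>X\<close>.\<close>
        have "?d Y \<noteq> ?p Y"
        proof
          assume tight: "?d Y = ?p Y"
          have XY: "X \<inter> Y \<subseteq> V" "X \<inter> Y \<noteq> {}" "X \<union> Y \<subseteq> V" "X \<union> Y \<noteq> {}"
            using X Y uv True by (auto simp: crit_def)
          have dX: "?d X = ?p X" using X by (simp add: crit_def)
          note ineqs = entering_submodular[OF finA, of X Y] missed_supermodular[OF fin(2), of R X Y]
            le[OF XY(1,2)] le[OF XY(3,4)]
          have "?d (X \<inter> Y) = ?p (X \<inter> Y)" using ineqs tight dX by linarith
          moreover have "R i \<inter> (X \<inter> Y) \<noteq> {}"
          proof
            assume "R i \<inter> (X \<inter> Y) = {}"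
            moreover have "R i \<inter> X \<noteq> {}" using X by (simp add: crit_def)
            ultimately show False
              using missed_supermodular_strict[of I i R X Y] fin(2) i meets ineqs tight dX by linarith
          qed
          ultimately have "crit (X \<inter> Y)" using XY uv True by (auto simp: crit_def)
          then have "X \<inter> Y = X" by (rule min) simp
          then show False using uv True by auto
        qed
        then show ?thesis using d le[OF Y] card_mono[OF finm sub] by simp
      qed
    qed
  qed
  then have "root_condition V (A - {(u, v)}) I (R(i := insert v (R i)))"
    by (simp add: root_condition_def)
  then show thesis using uv that by blast
qed

text \<open>Each index becomes a source joined to its roots; unit capacities suffice there because a
  source only emits one unit.\<close>

lemma root_condition_iff_cuts:
  assumes fin: "finite V" "finite I" and A: "A \<subseteq> V \<times> V" and C: "C \<subseteq> I \<times> V" and dis: "V \<inter> I = {}"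
  shows "root_condition V A I (\<lambda>i. C `` {i}) \<longleftrightarrow>
    (\<forall>t\<in>V. \<forall>Y\<subseteq>V \<union> I. t \<in> Y \<longrightarrow> card (I - Y) \<le> card (entering (A \<union> C) Y))"
    (is "?L \<longleftrightarrow> ?R")
proof
  have finA: "finite A" by (rule finite_subset[OF A]) (simp add: fin)
  have finC: "finite C" by (rule finite_subset[OF C]) (simp add: fin)
  assume L: ?L
  show ?R
  proof (intro ballI allI impI)
    fix t Y assume t: "t \<in> V" "t \<in> Y" and Y: "Y \<subseteq> V \<union> I"
    define X where "X = Y \<inter> V"
    have X: "X \<subseteq> V" "X \<noteq> {}" using t by (auto simp: X_def)
    \<comment> \<open>A source outside \<open>Y\<close> either has no root in \<open>X\<close> and
      counts as missed, or contributes a root arc entering \<open>Y\<close>. The chosen root arcs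
      are distinct because their tails are.\<close>
    define J where "J = {i \<in> I - Y. C `` {i} \<inter> X \<noteq> {}}"
    define f where "f i = (i, SOME v. v \<in> C `` {i} \<inter> X)" for i
    have f: "f i \<in> C \<and> fst (f i) = i \<and> snd (f i) \<in> X" if "i \<in> J" for i
    proof -
      have "\<exists>v. v \<in> C `` {i} \<inter> X" using that by (auto simp: J_def)
      then have "(SOME v. v \<in> C `` {i} \<inter> X) \<in> C `` {i} \<inter> X" by (rule someI_ex)
      then show ?thesis by (auto simp: f_def)
    qed
    have "I - Y \<subseteq> missed I (\<lambda>i. C `` {i}) X \<union> J" by (auto simp: missed_def J_def)
    then have "card (I - Y) \<le> card (missed I (\<lambda>i. C `` {i}) X \<union> J)"
      using fin by (intro card_mono) (auto simp: missed_def J_def)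
    also have "\<dots> \<le> card (missed I (\<lambda>i. C `` {i}) X) + card J" by (rule card_Un_le)
    also have "\<dots> \<le> card (entering A X) + card (f ` J)"
    proof (rule add_mono)
      show "card (missed I (\<lambda>i. C `` {i}) X) \<le> card (entering A X)"
        using L X by (simp add: root_condition_def)
      have "inj_on f J" by (auto simp: inj_on_def f_def)
      then show "card J \<le> card (f ` J)" by (simp add: card_image)
    qed
    also have "\<dots> = card (entering A X \<union> f ` J)"
    proof (rule card_Un_disjoint[symmetric])
      have "e \<notin> entering A X" if "e \<in> f ` J" for e
        using that f A dis by (fastforce simp: entering_def J_def)
      then show "entering A X \<inter> f ` J = {}" by blast
    qed (use fin finA in \<open>auto simp: J_def\<close>)
    also have "\<dots> \<le> card (entering (A \<union> C) Y)"
    proof (rule card_mono)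
      show "finite (entering (A \<union> C) Y)" using finA finC by simp
      have "f i \<in> entering (A \<union> C) Y" if "i \<in> J" for i
        using f[OF that] that unfolding entering_def J_def X_def by auto
      moreover have "entering A X \<subseteq> entering (A \<union> C) Y"
        using A by (auto simp: entering_def X_def)
      ultimately show "entering A X \<union> f ` J \<subseteq> entering (A \<union> C) Y" by blast
    qed
    finally show "card (I - Y) \<le> card (entering (A \<union> C) Y)" .
  qed
next
  have finA: "finite A" by (rule finite_subset[OF A]) (simp add: fin)
  assume R: ?R
  show ?L
    unfolding root_condition_def
  proof (intro allI impI)
    fix X assume X: "X \<subseteq> V" "X \<noteq> {}"
    then obtain t where t: "t \<in> X" by blast
    \<comment> \<open>Taking in every source with a root in \<open>X\<close> leaves no root arc
      entering \<open>Y\<close>, so the cut reduces to the arcs entering \<open>X\<close>.\<close>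
    define Y where "Y = X \<union> {i \<in> I. C `` {i} \<inter> X \<noteq> {}}"
    have "missed I (\<lambda>i. C `` {i}) X = I - Y" using X dis by (auto simp: missed_def Y_def)
    also have "card (I - Y) \<le> card (entering (A \<union> C) Y)"
    proof -
      have "Y \<subseteq> V \<union> I" "t \<in> Y" "t \<in> V" using t X(1) by (auto simp: Y_def)
      then show ?thesis using R by blast
    qed
    also have "\<dots> \<le> card (entering A X)"
    proof (rule card_mono)
      show "entering (A \<union> C) Y \<subseteq> entering A X"
      proof
        fix e assume e: "e \<in> entering (A \<union> C) Y"
        obtain a b where ab: "e = (a, b)" by (cases e)
        have "b \<in> V" using e A C unfolding ab entering_def by auto
        then have "b \<in> X" "a \<notin> Y" using e dis unfolding ab entering_def Y_def by auto
        moreover from this have "(a, b) \<notin> C" using C by (auto simp: Y_def)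
        ultimately show "e \<in> entering A X" using e unfolding ab entering_def Y_def by auto
      qed
    qed (simp add: finA)
    finally show "card (missed I (\<lambda>i. C `` {i}) X) \<le> card (entering A X)" .
  qed
qed

subsection \<open>The greedy algorithm\<close>

text \<open>A partial packing is a list of pairs \<open>(i, e)\<close>, meaning that the arc \<open>e\<close> is used by the
  \<open>i\<close>-th branching.\<close>

definition unused :: "('n \<times> 'n) list \<Rightarrow> ('n \<times> 'n \<times> 'n) list \<Rightarrow> ('n \<times> 'n) list" where
  "unused A S = filter (\<lambda>e. \<forall>q\<in>set S. snd q \<noteq> e) A"

definition covered :: "('n \<times> 'n) list \<Rightarrow> ('n \<times> 'n \<times> 'n) list \<Rightarrow> ('n \<times> 'n) list" where
  "covered C S = C @ map (\<lambda>q. (fst q, snd (snd q))) S"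

definition extendable ::
    "'n list \<Rightarrow> ('n \<times> 'n) list \<Rightarrow> 'n list \<Rightarrow> ('n \<times> 'n) list \<Rightarrow> ('n \<times> 'n \<times> 'n) list \<Rightarrow> bool" where
  "extendable V A I C S \<longleftrightarrow> (\<forall>t\<in>set V. feasible (unused A S @ covered C S) (V @ I) t I)"

definition candidates ::
    "'n list \<Rightarrow> ('n \<times> 'n) list \<Rightarrow> 'n list \<Rightarrow> ('n \<times> 'n) list \<Rightarrow> ('n \<times> 'n \<times> 'n) list \<Rightarrow>
     ('n \<times> 'n \<times> 'n) list" where
  "candidates V A I C S =
     filter (\<lambda>q. snd q \<in> set (unused A S) \<and> (fst q, fst (snd q)) \<in> set (covered C S) \<and>
       (fst q, snd (snd q)) \<notin> set (covered C S) \<and> extendable V A I C (q # S)) (List.product I A)"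

text \<open>Rebuilt as a filter of all triples rather than by \<open>Cons\<close>, which bounds the
  size by that of the product.\<close>

definition grow ::
    "'n list \<Rightarrow> ('n \<times> 'n) list \<Rightarrow> 'n list \<Rightarrow> ('n \<times> 'n) list \<Rightarrow> ('n \<times> 'n \<times> 'n) list \<Rightarrow>
     ('n \<times> 'n \<times> 'n) list" where
  "grow V A I C S =
     (if candidates V A I C S = [] then S
      else filter (\<lambda>q. q \<in> set S \<or> q = hd (candidates V A I C S)) (List.product I A))"

definition pack ::
    "'n list \<Rightarrow> ('n \<times> 'n) list \<Rightarrow> 'n list \<Rightarrow> ('n \<times> 'n) list \<Rightarrow> ('n \<times> 'n \<times> 'n) list" where
  "pack V A I C = fold (\<lambda>_. grow V A I C) (List.product I A) []"

lemma polytime_pack [polytime_intros]: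
  assumes V: "polytime V" and A: "polytime A" and I: "polytime I" and C: "polytime C"
  shows "polytime (\<lambda>x. pack (V x) (A x) (I x) (C x))"
proof -
  have unused: "polytime (\<lambda>x. unused (A x) (S x))"
    if "polytime A" "polytime S" for A S :: "'x::encodable \<Rightarrow> _"
    unfolding unused_def
    by (intro polytime_intros that polytime_comp[OF that(1)] polytime_comp[OF that(2)])
  have covered: "polytime (\<lambda>x. covered (C x) (S x))"
    if "polytime C" "polytime S" for C S :: "'x::encodable \<Rightarrow> _"
    unfolding covered_def by (intro polytime_intros that)
  have extendable: "polytime (\<lambda>x. extendable (V x) (A x) (I x) (C x) (S x))"
    if "polytime V" "polytime A" "polytime I" "polytime C" "polytime S"
    for V A I C S :: "'x::encodable \<Rightarrow> _"
    unfolding extendable_def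
    by (intro polytime_intros unused covered that polytime_comp[OF that(1)] polytime_comp[OF that(2)]
        polytime_comp[OF that(3)] polytime_comp[OF that(4)] polytime_comp[OF that(5)])
  have candidates: "polytime (\<lambda>x. candidates (V x) (A x) (I x) (C x) (S x))"
    if "polytime V" "polytime A" "polytime I" "polytime C" "polytime S"
    for V A I C S :: "'x::encodable \<Rightarrow> _"
    unfolding candidates_def
    by (intro polytime_intros unused covered extendable that polytime_comp[OF that(1)]
        polytime_comp[OF that(2)] polytime_comp[OF that(3)] polytime_comp[OF that(4)]
        polytime_comp[OF that(5)])
  show ?thesis
    unfolding pack_def
  proof (rule polytime_fold_invariant[where
        I = "\<lambda>x S. size_of S \<le> size_of (List.product (I x) (A x))" and
        g = "\<lambda>x. List.product (I x) (A x)"])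
    show "polytime (\<lambda>p. grow (V (fst p)) (A (fst p)) (I (fst p)) (C (fst p)) (snd (snd p)))"
      unfolding grow_def
      by (intro polytime_intros candidates polytime_comp[OF V] polytime_comp[OF A]
          polytime_comp[OF I] polytime_comp[OF C])
    show "size_of (grow (V x) (A x) (I x) (C x) S) \<le> size_of (List.product (I x) (A x))"
      if "size_of S \<le> size_of (List.product (I x) (A x))" for x S
      using that by (auto simp: grow_def size_of_filter_le)
  qed (auto intro!: polytime_intros assms simp: Suc_le_eq)
qed

section \<open>Correctness of the greedy packing\<close>

locale packing =
  fixes V :: "'n list" and A :: "('n \<times> 'n) list" and I :: "'n list" and C :: "('n \<times> 'n) list"
  assumes A: "set A \<subseteq> set V \<times> set V" and C: "set C \<subseteq> set I \<times> set V"
    and dis: "set V \<inter> set I = {}" and distinct: "distinct I"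
begin

text \<open>For each index this describes a forest hanging from its roots. Acyclicity is recorded
  because it supplies the well-founded relation along which \<open>unique_walks\<close>
  proceeds.\<close>

definition valid :: "('n \<times> 'n \<times> 'n) list \<Rightarrow> bool" where
  "valid S \<longleftrightarrow> set S \<subseteq> set I \<times> set A \<and>
     (\<forall>i j e. (i, e) \<in> set S \<longrightarrow> (j, e) \<in> set S \<longrightarrow> i = j) \<and>
     (\<forall>i u v. (i, u, v) \<in> set S \<longrightarrow> (i, v) \<notin> set C \<and> (i, u) \<in> set (covered C S)) \<and>
     (\<forall>i u u' v. (i, u, v) \<in> set S \<longrightarrow> (i, u', v) \<in> set S \<longrightarrow> u = u') \<and>
     (\<forall>i. acyclic {e. (i, e) \<in> set S})"

lemma set_covered: "set (covered C S) = set C \<union> {(i, v). \<exists>u. (i, u, v) \<in> set S}"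
  by (force simp: covered_def)

lemma set_unused: "set (unused A S) = set A - snd ` set S"
  by (force simp: unused_def)

lemma extendable_iff:
  assumes "set S \<subseteq> set I \<times> set A"
  shows "extendable V A I C S \<longleftrightarrow>
    root_condition (set V) (set A - snd ` set S) (set I) (\<lambda>i. set (covered C S) `` {i})"
proof -
  let ?A = "set A - snd ` set S" and ?C = "set (covered C S)"
  have E: "set (unused A S @ covered C S) = ?A \<union> ?C" by (simp add: set_unused)
  have sub: "?A \<subseteq> set V \<times> set V" "?C \<subseteq> set I \<times> set V"
    using A C assms by (auto simp: set_covered)
  have "feasible (unused A S @ covered C S) (V @ I) t I \<longleftrightarrow>
      (\<forall>Y\<subseteq>set V \<union> set I. t \<in> Y \<longrightarrow> card (set I - Y) \<le> card (entering (?A \<union> ?C) Y))"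
    if "t \<in> set V" for t
    using feasible_iff[of "unused A S @ covered C S" "V @ I" t I] sub that distinct unfolding E by auto
  then show ?thesis
    unfolding extendable_def root_condition_iff_cuts[OF _ _ sub dis, simplified] by simp
qed

lemma candidatesD:
  assumes "(i, u, v) \<in> set (candidates V A I C S)"
  shows "i \<in> set I" "(u, v) \<in> set A" "\<And>j. (j, u, v) \<notin> set S" "(i, u) \<in> set (covered C S)"
    "(i, v) \<notin> set (covered C S)" "extendable V A I C ((i, u, v) # S)"
  using assms by (auto simp: candidates_def unused_def)

text \<open>Stated for \<open>set S'\<close> because \<open>grow\<close> stores the triples in
  another order.\<close>

lemma valid_extend:
  assumes S: "valid S" and q: "(i, u, v) \<in> set (candidates V A I C S)"
    and S': "set S' = insert (i, u, v) (set S)"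
  shows "valid S'"
proof -
  note c = candidatesD[OF q]
  have cov: "set (covered C S') = insert (i, v) (set (covered C S))"
    unfolding set_covered S' by auto
  have "acyclic {e. (j, e) \<in> set S'}" for j
  proof (cases "j = i")
    case True
    let ?r = "{e. (i, e) \<in> set S}"
    have "u \<noteq> v" using c by auto
    \<comment> \<open>Tails are covered and \<open>v\<close> is not, so the new arc cannot close a
      cycle.\<close>
    have no_out: "(v, w) \<notin> ?r" for w
      using S c(5) by (auto simp: valid_def)
    have "(v, u) \<notin> ?r\<^sup>*"
    proof
      assume "(v, u) \<in> ?r\<^sup>*"
      then show False by (rule converse_rtranclE) (use \<open>u \<noteq> v\<close> no_out in auto)
    qed
    moreover have "{e. (j, e) \<in> set S'} = insert (u, v) ?r" using S' True by auto
    ultimately show ?thesis using S by (simp add: acyclic_insert valid_def)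
  next
    case False
    then have "{e. (j, e) \<in> set S'} = {e. (j, e) \<in> set S}" using S' by auto
    then show ?thesis using S by (simp add: valid_def)
  qed
  moreover have "(i, w, v) \<notin> set S" for w using c(5) by (auto simp: set_covered)
  moreover have "(i, v) \<notin> set C" using c(5) by (auto simp: set_covered)
  ultimately show ?thesis
    using S c(1-4) unfolding valid_def cov S' by auto
qed

lemma set_grow:
  assumes "valid S" "candidates V A I C S \<noteq> []"
  shows "set (grow V A I C S) = insert (hd (candidates V A I C S)) (set S)"
proof -
  have "hd (candidates V A I C S) \<in> set (candidates V A I C S)" using assms(2) by simp
  then have "hd (candidates V A I C S) \<in> set I \<times> set A" by (auto simp: candidates_def)
  then show ?thesis using assms by (auto simp: grow_def valid_def)
qed

lemma valid_grow:
  assumes "valid S"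
  shows "valid (grow V A I C S)"
proof (cases "candidates V A I C S = []")
  case True
  then show ?thesis using assms by (simp add: grow_def)
next
  case False
  obtain i u v where q: "hd (candidates V A I C S) = (i, u, v)"
    by (cases "hd (candidates V A I C S)")
  then have "(i, u, v) \<in> set (candidates V A I C S)" using False by (metis hd_in_set)
  then show ?thesis using set_grow[OF assms False] valid_extend[OF assms] unfolding q by blast
qed

lemma valid_pack: "valid (pack V A I C)"
proof -
  have "valid (fold (\<lambda>_. grow V A I C) ws S)" if "valid S" for S and ws :: "('n \<times> 'n \<times> 'n) list"
    using that by (induction ws arbitrary: S) (auto intro: valid_grow)
  moreover have "valid []" by (auto simp: valid_def acyclic_def)
  ultimately show ?thesis unfolding pack_def .
qed

definition full :: "('n \<times> 'n \<times> 'n) list \<Rightarrow> bool" where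
  "full S \<longleftrightarrow> set I \<times> set V \<subseteq> set (covered C S)"

lemma candidates_nonempty:
  assumes S: "valid S" "extendable V A I C S" and "\<not> full S"
  shows "candidates V A I C S \<noteq> []"
proof -
  obtain i v0 where i: "i \<in> set I" "v0 \<in> set V" "(i, v0) \<notin> set (covered C S)"
    using assms(3) by (auto simp: full_def)
  have SIA: "set S \<subseteq> set I \<times> set A" using S(1) by (simp add: valid_def)
  let ?R = "\<lambda>i. set (covered C S) `` {i}"
  have "?R i \<subseteq> set V" using A C SIA by (auto simp: set_covered)
  moreover have "?R i \<noteq> set V" using i by auto
  moreover have "set A - snd ` set S \<subseteq> set V \<times> set V" using A by auto
  moreover have "root_condition (set V) (set A - snd ` set S) (set I) ?R"
    using S(2) unfolding extendable_iff[OF SIA] .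
  ultimately obtain u v where uv: "(u, v) \<in> set A - snd ` set S" "u \<in> ?R i" "v \<notin> ?R i"
    "root_condition (set V) (set A - snd ` set S - {(u, v)}) (set I) (?R(i := insert v (?R i)))"
    using i(1) by (elim root_condition_extend[rotated 2]) auto
  have "set ((i, u, v) # S) \<subseteq> set I \<times> set A" using SIA uv(1) i(1) by auto
  moreover have "set A - snd ` set S - {(u, v)} = set A - snd ` set ((i, u, v) # S)" by auto
  moreover have "?R(i := insert v (?R i)) = (\<lambda>j. set (covered C ((i, u, v) # S)) `` {j})"
    by (auto simp: set_covered fun_eq_iff)
  ultimately have "extendable V A I C ((i, u, v) # S)"
    using uv(4) by (simp add: extendable_iff)
  then have "(i, u, v) \<in> set (candidates V A I C S)"
    using uv i(1) by (auto simp: candidates_def set_unused)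
  then show ?thesis by auto
qed

text \<open>A round without candidates means that the packing is full already. Every other round
  adds a new triple, and once all triples are in use no candidate is left. Hence
  \<open>length (List.product I A)\<close> rounds suffice.\<close>

theorem full_pack:
  assumes "root_condition (set V) (set A) (set I) (\<lambda>i. set C `` {i})"
  shows "full (pack V A I C)"
proof -
  have "full (fold (\<lambda>_. grow V A I C) ws S)"
    if "valid S" "extendable V A I C S" "card (set I \<times> set A) \<le> card (set S) + length ws"
    for S and ws :: "('n \<times> 'n \<times> 'n) list"
    using that
  proof (induction ws arbitrary: S)
    case Nil
    have "set S \<subseteq> set I \<times> set A" using Nil.prems(1) by (simp add: valid_def)
    then have "set S = set I \<times> set A" using Nil.prems(3) by (intro card_seteq) auto
    moreover have "set (candidates V A I C S) \<subseteq> set I \<times> set A - set S"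
      by (auto simp: candidates_def unused_def)
    ultimately have "candidates V A I C S = []" by auto
    then show ?case using candidates_nonempty[OF Nil.prems(1,2)] by auto
  next
    case (Cons w ws)
    show ?case
    proof (cases "candidates V A I C S = []")
      case True
      then have "full S" using candidates_nonempty[OF Cons.prems(1,2)] by auto
      moreover have "fold (\<lambda>_. grow V A I C) us S = S" for us :: "('n \<times> 'n \<times> 'n) list"
        using True by (induction us) (auto simp: grow_def)
      from this[of "w # ws"] show ?thesis using \<open>full S\<close> by (simp del: fold_simps)
    next
      case False
      obtain i u v where q: "hd (candidates V A I C S) = (i, u, v)"
        by (cases "hd (candidates V A I C S)")
      then have c: "(i, u, v) \<in> set (candidates V A I C S)" using False by (metis hd_in_set)
      have S': "set (grow V A I C S) = insert (i, u, v) (set S)"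
        using set_grow[OF Cons.prems(1) False] unfolding q .
      have v: "valid (grow V A I C S)" using Cons.prems(1) by (rule valid_grow)
      have "(i, u, v) \<notin> set S" using candidatesD(3)[OF c] .
      then have card: "card (set (grow V A I C S)) = Suc (card (set S))" unfolding S' by simp
      have sub: "set (grow V A I C S) \<subseteq> set I \<times> set A" "set ((i, u, v) # S) \<subseteq> set I \<times> set A"
        using v S' by (auto simp: valid_def)
      have "set (covered C (grow V A I C S)) = set (covered C ((i, u, v) # S))"
        unfolding set_covered S' by simp
      then have "extendable V A I C (grow V A I C S)"
        using candidatesD(6)[OF c] unfolding extendable_iff[OF sub(1)] extendable_iff[OF sub(2)] S'
        by simp
      from Cons.IH[OF v this] show ?thesis using Cons.prems(3) card by simp
    qed
  qed
  moreover have "valid []" by (auto simp: valid_def acyclic_def)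
  moreover have "extendable V A I C []"
    using assms by (simp add: extendable_iff set_covered)
  moreover have "card (set I \<times> set A) \<le> length (List.product I A)"
    using card_length[of "List.product I A"] by simp
  ultimately show ?thesis unfolding pack_def by simp
qed

end

section \<open>Temporal walks and branchings\<close>

lemma twalk_nonempty: "twalk G w \<Longrightarrow> w \<noteq> []"
  by (induction rule: twalk.induct) auto

lemma twalk_last_tverts: "twalk G w \<Longrightarrow> last w = TVertex x \<Longrightarrow> x \<in> tverts G"
  by (induction rule: twalk.induct) (auto split: if_splits)

lemma twalk_snoc_wait:
  "twalk G w \<Longrightarrow> last w = TVertex (v, t) \<Longrightarrow> (v, t + 1) \<in> tverts G \<Longrightarrow> twalk G (w @ [TVertex (v, t + 1)])"
proof (induction rule: twalk.induct)
  case (single x)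
  then show ?case using twalk.wait[of v t G "[]"] twalk.single[of "(v, t + 1)" G] by simp
next
  case (wait v' t' w)
  then show ?case using twalk.wait[of v' t' G "w @ [TVertex (v, t + 1)]"] by simp
next
  case (edge x y w)
  then show ?case using twalk.edge[of x G y "w @ [TVertex (v, t + 1)]"] by simp
qed

lemma twalk_snoc_edge:
  "twalk G w \<Longrightarrow> last w = TVertex x \<Longrightarrow> (x, y) \<in> tedges G \<Longrightarrow> y \<in> tverts G \<Longrightarrow>
    twalk G (w @ [TEdge x y, TVertex y])"
proof (induction rule: twalk.induct)
  case (single x')
  then show ?case using twalk.edge[of x G y "[]"] twalk.single[of y G] by simp
next
  case (wait v' t' w)
  then show ?case using twalk.wait[of v' t' G "w @ [TEdge x y, TVertex y]"] by simp
next
  case (edge x' y' w)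
  then show ?case using twalk.edge[of x' G y' "w @ [TEdge x y, TVertex y]"] by simp
qed

text \<open>Walks are built from the front, but their uniqueness is argued backwards from the last
  vertex, hence this decomposition at the other end.\<close>

lemma twalk_snoc_cases:
  assumes "twalk G w"
  shows "(\<exists>x. w = [TVertex x]) \<or>
    (\<exists>w' v t. twalk G w' \<and> last w' = TVertex (v, t) \<and> w = w' @ [TVertex (v, t + 1)]) \<or>
    (\<exists>w' x y. twalk G w' \<and> last w' = TVertex x \<and> (x, y) \<in> tedges G \<and> w = w' @ [TEdge x y, TVertex y])"
  using assms
proof (induction rule: twalk.induct)
  case (single x)
  then show ?case by blast
next
  case (wait v t w)
  let ?a = "TVertex (v, t)" and ?b = "TVertex (v, t + 1)"
  from wait.IH consider "w = []"
    | w' v' t' where "twalk G w'" "last w' = TVertex (v', t')" "?b # w = w' @ [TVertex (v', t' + 1)]"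
    | w' x y where "twalk G w'" "last w' = TVertex x" "(x, y) \<in> tedges G" "?b # w = w' @ [TEdge x y, TVertex y]"
    by auto
  then show ?case
  proof cases
    case 1
    then show ?thesis using twalk.single[OF wait.hyps(1)] by (intro disjI2 disjI1 exI[of _ "[?a]"]) auto
  next
    case 2
    from twalk_nonempty[OF 2(1)] 2(3) obtain w'' where w': "w' = ?b # w''" by (cases w') auto
    then have "twalk G (?a # w')" using 2(1) twalk.wait[OF wait.hyps(1), of w''] by simp
    then show ?thesis using 2 w' by (intro disjI2 disjI1 exI[of _ "?a # w'"]) auto
  next
    case 3
    from twalk_nonempty[OF 3(1)] 3(4) obtain w'' where w': "w' = ?b # w''" by (cases w') auto
    then have "twalk G (?a # w')" using 3(1) twalk.wait[OF wait.hyps(1), of w''] by simp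
    then show ?thesis using 3 w' by (intro disjI2 exI[of _ "?a # w'"] exI[of _ x] exI[of _ y]) auto
  qed
next
  case (edge x0 y0 w)
  let ?a = "TVertex x0" and ?b = "TVertex y0" and ?e = "TEdge x0 y0"
  from edge.IH consider "w = []"
    | w' v' t' where "twalk G w'" "last w' = TVertex (v', t')" "?b # w = w' @ [TVertex (v', t' + 1)]"
    | w' x y where "twalk G w'" "last w' = TVertex x" "(x, y) \<in> tedges G" "?b # w = w' @ [TEdge x y, TVertex y]"
    by auto
  then show ?case
  proof cases
    case 1
    then show ?thesis using twalk.single[OF edge.hyps(1)] edge.hyps(2)
      by (intro disjI2 exI[of _ "[?a]"] exI[of _ x0] exI[of _ y0]) auto
  next
    case 2
    from twalk_nonempty[OF 2(1)] 2(3) obtain w'' where w': "w' = ?b # w''" by (cases w') auto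
    then have "twalk G (?a # ?e # w')" using 2(1) twalk.edge[OF edge.hyps(1,2), of w''] by simp
    then show ?thesis using 2 w' by (intro disjI2 disjI1 exI[of _ "?a # ?e # w'"]) auto
  next
    case 3
    from twalk_nonempty[OF 3(1)] 3(4) obtain w'' where w': "w' = ?b # w''" by (cases w') auto
    then have "twalk G (?a # ?e # w')" using 3(1) twalk.edge[OF edge.hyps(1,2), of w''] by simp
    then show ?thesis using 3 w' by (intro disjI2 exI[of _ "?a # ?e # w'"] exI[of _ x] exI[of _ y]) auto
  qed
qed

text \<open>Waiting does not change the vertex, so a walk can enter \<open>X\<close> only along a
  temporal edge.\<close>

lemma twalk_crossing:
  assumes "twalk G w" "hd w = TVertex x" "fst x \<notin> X" "last w = TVertex y" "fst y \<in> X"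
  shows "\<exists>u t v t'. ((u, t), (v, t')) \<in> tedges G \<and> u \<notin> X \<and> v \<in> X"
  using assms
proof (induction arbitrary: x rule: twalk.induct)
  case (wait v t w)
  then show ?case by auto
next
  case (edge x0 y0 w)
  show ?case
  proof (cases "fst y0 \<in> X")
    case True
    then show ?thesis using edge by (metis list.sel(1) prod.collapse titem.inject(1))
  next
    case False
    then show ?thesis using edge.IH[of y0] edge.prems by auto
  qed
qed auto

section \<open>First active times and uniqueness of walks\<close>

definition first_active :: "'v tdigraph \<Rightarrow> 'v \<Rightarrow> nat \<Rightarrow> bool" where
  "first_active G v t \<longleftrightarrow> t \<in> active G v \<and> (\<forall>s\<in>active G v. t \<le> s)"

locale interval_digraph =
  fixes G :: "'v tdigraph"
  assumes G: "temporal_digraph G"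
    and interval: "\<And>v. v \<in> verts G \<Longrightarrow> \<exists>a b. a \<le> b \<and> active G v = {a..b}"
begin

text \<open>This is what the intervals are for: every active time other than the first can be
  reached by waiting.\<close>

lemma predecessor_active:
  assumes "(v, t) \<in> tverts G" "\<not> first_active G v t"
  obtains s where "t = s + 1" "(v, s) \<in> tverts G"
proof -
  have v: "v \<in> verts G" "t \<in> active G v" using assms(1) by (auto simp: tverts_def)
  obtain a b where ab: "active G v = {a..b}" using interval[OF v(1)] by blast
  have "a < t" using assms(2) v(2) ab by (auto simp: first_active_def)
  then have "t = t - 1 + 1" "(v, t - 1) \<in> tverts G" using v ab by (auto simp: tverts_def)
  then show thesis by (rule that)
qed

lemma first_active_unique: "first_active G v t \<Longrightarrow> first_active G v t' \<Longrightarrow> t = t'"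
  by (auto simp: first_active_def intro: antisym)

lemma first_active_Suc: "first_active G v (t + 1) \<Longrightarrow> (v, t) \<notin> tverts G"
  by (auto simp: first_active_def tverts_def)

lemma first_active_exists: "v \<in> verts G \<Longrightarrow> \<exists>t. first_active G v t"
  using interval[of v] by (auto simp: first_active_def)

text \<open>Nested induction, outside along the arcs \<open>r\<close> of the branching and inside
  over the time at a fixed vertex. After the first active time the last step of a walk must be a
  wait; at the first active time it is the unique incoming edge, or the walk is trivial because it
  ends at a root.\<close>

lemma unique_walks:
  assumes B: "temporal_digraph B" and tv: "tverts B = tverts G"
    and R: "\<And>v t. (v, t) \<in> R \<Longrightarrow> first_active G v t"
    and wf: "wf r"
    and into: "\<And>u t v t'. ((u, t), (v, t')) \<in> tedges B \<Longrightarrow>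
      first_active G v t' \<and> (v, t') \<notin> R \<and> (u, v) \<in> r"
    and uniq: "\<And>x x' y. (x, y) \<in> tedges B \<Longrightarrow> (x', y) \<in> tedges B \<Longrightarrow> x = x'"
    and ex: "\<And>v t. (v, t) \<in> tverts G \<Longrightarrow> first_active G v t \<Longrightarrow> (v, t) \<notin> R \<Longrightarrow> \<exists>x. (x, (v, t)) \<in> tedges B"
    and "(v, t) \<in> tverts G"
  shows "\<exists>!w. twalk B w \<and> hd w \<in> TVertex ` R \<and> last w = TVertex (v, t)"
  using wf assms(8)
proof (induction v arbitrary: t rule: wf_induct_rule)
  case (less v)
  note IHv = less.IH
  from less.prems show ?case
  proof (induction t rule: less_induct)
    case inner: (less t)
    note IHt = inner.IH and vt = inner.prems
    show ?case
    proof (cases "first_active G v t")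
      case first: True
      have no_wait: False if "twalk B w'" "last w' = TVertex (v', t')" "(v, t) = (v', t' + 1)" for w' v' t'
        using twalk_last_tverts[OF that(1,2)] first_active_Suc[of v t'] first that(3) tv by auto
      show ?thesis
      proof (cases "(v, t) \<in> R")
        case True
        show ?thesis
        proof (rule ex1I[of _ "[TVertex (v, t)]"])
          show "twalk B [TVertex (v, t)] \<and> hd [TVertex (v, t)] \<in> TVertex ` R \<and>
              last [TVertex (v, t)] = TVertex (v, t)"
            using True vt tv by (auto intro: twalk.single)
          fix w assume w: "twalk B w \<and> hd w \<in> TVertex ` R \<and> last w = TVertex (v, t)"
          from w have "twalk B w" by blast
          from twalk_snoc_cases[OF this] show "w = [TVertex (v, t)]"
          proof (elim disjE exE conjE)
            fix w' v' t' assume "twalk B w'" "last w' = TVertex (v', t')" "w = w' @ [TVertex (v', t' + 1)]"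
            then show ?thesis using no_wait[of w' v' t'] w by simp
          next
            fix w' x y assume "(x, y) \<in> tedges B" "w = w' @ [TEdge x y, TVertex y]"
            then show ?thesis using w into[of "fst x" "snd x" v t] True by simp
          qed (use w in auto)
        qed
      next
        case False
        then obtain u s where e: "((u, s), (v, t)) \<in> tedges B" using ex[OF vt first] by auto
        have us: "(u, s) \<in> tverts G"
          using e B tv unfolding temporal_digraph_def tedges_def tverts_def by blast
        from IHv[OF _ us] into[OF e] obtain w0 where
          w0: "twalk B w0" "hd w0 \<in> TVertex ` R" "last w0 = TVertex (u, s)" and
          w0_uniq: "\<And>w. twalk B w \<Longrightarrow> hd w \<in> TVertex ` R \<Longrightarrow> last w = TVertex (u, s) \<Longrightarrow> w = w0"
          by blast
        let ?w = "w0 @ [TEdge (u, s) (v, t), TVertex (v, t)]"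
        show ?thesis
        proof (rule ex1I[of _ ?w])
          show "twalk B ?w \<and> hd ?w \<in> TVertex ` R \<and> last ?w = TVertex (v, t)"
            using twalk_snoc_edge[OF w0(1,3) e] vt tv w0(2) twalk_nonempty[OF w0(1)] by simp
          fix w assume w: "twalk B w \<and> hd w \<in> TVertex ` R \<and> last w = TVertex (v, t)"
          from w have "twalk B w" by blast
          from twalk_snoc_cases[OF this] show "w = ?w"
          proof (elim disjE exE conjE)
            fix w' v' t' assume "twalk B w'" "last w' = TVertex (v', t')" "w = w' @ [TVertex (v', t' + 1)]"
            then show ?thesis using no_wait[of w' v' t'] w by simp
          next
            fix w' x y assume a: "twalk B w'" "last w' = TVertex x" "(x, y) \<in> tedges B"
              "w = w' @ [TEdge x y, TVertex y]"
            have y: "y = (v, t)" using w a(4) by simp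
            have x: "x = (u, s)" using uniq[OF a(3)[unfolded y] e] .
            have "w' = w0" using a w twalk_nonempty[OF a(1)] unfolding x by (intro w0_uniq) auto
            then show ?thesis using a(4) x y by simp
          next
            fix x assume "w = [TVertex x]"
            then show ?thesis using w False by auto
          qed
        qed
      qed
    next
      case False
      obtain s where s: "t = s + 1" "(v, s) \<in> tverts G"
        using predecessor_active[OF vt False] .
      have "s < t" using s(1) by simp
      from IHt[OF this s(2)] obtain w0 where
        w0: "twalk B w0" "hd w0 \<in> TVertex ` R" "last w0 = TVertex (v, s)" and
        w0_uniq: "\<And>w. twalk B w \<Longrightarrow> hd w \<in> TVertex ` R \<Longrightarrow> last w = TVertex (v, s) \<Longrightarrow> w = w0"
        by blast
      let ?w = "w0 @ [TVertex (v, t)]"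
      show ?thesis
      proof (rule ex1I[of _ ?w])
        show "twalk B ?w \<and> hd ?w \<in> TVertex ` R \<and> last ?w = TVertex (v, t)"
          using twalk_snoc_wait[OF w0(1,3)] vt tv w0(2) twalk_nonempty[OF w0(1)] s(1) by simp
        fix w assume w: "twalk B w \<and> hd w \<in> TVertex ` R \<and> last w = TVertex (v, t)"
        from w have "twalk B w" by blast
        from twalk_snoc_cases[OF this] show "w = ?w"
        proof (elim disjE exE conjE)
          fix w' v' t' assume a: "twalk B w'" "last w' = TVertex (v', t')" "w = w' @ [TVertex (v', t' + 1)]"
          then have "w' = w0" using w s twalk_nonempty[OF a(1)] by (intro w0_uniq) auto
          then show ?thesis using a w by simp
        next
          fix w' x y assume "(x, y) \<in> tedges B" "w = w' @ [TEdge x y, TVertex y]"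
          then show ?thesis using w into[of "fst x" "snd x" v t] False by simp
        next
          fix x assume "w = [TVertex x]"
          then show ?thesis using w False R by auto
        qed
      qed
    qed
  qed
qed

section \<open>Constraints on every spanning branching\<close>

context
  fixes R B
  assumes branching: "temporal_spanning_branching G R B"
begin

lemma branching_walk:
  assumes "x \<in> tverts G"
  obtains w where "twalk B w" "hd w \<in> TVertex ` R" "last w = TVertex x"
  using branching assms unfolding temporal_spanning_branching_def by blast

lemma branching_walk_unique:
  assumes "twalk B w" "hd w \<in> TVertex ` R" "last w = TVertex x"
    "twalk B w'" "hd w' \<in> TVertex ` R" "last w' = TVertex x" "x \<in> tverts G"
  shows "w = w'"
  using branching assms unfolding temporal_spanning_branching_def by blast

lemma branching_tverts: "x \<in> tverts G \<Longrightarrow> x \<in> tverts B"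
  using branching_walk twalk_last_tverts by metis

text \<open>Otherwise the trivial walk at the root competes with the walk that waits from the
  preceding time.\<close>

lemma branching_root_first:
  assumes "(v, t) \<in> R" "(v, t) \<in> tverts G"
  shows "first_active G v t"
proof (rule ccontr)
  assume "\<not> first_active G v t"
  with assms(2) obtain s where s: "t = s + 1" "(v, s) \<in> tverts G" by (rule predecessor_active)
  obtain w where w: "twalk B w" "hd w \<in> TVertex ` R" "last w = TVertex (v, s)"
    using branching_walk[OF s(2)] .
  have "w @ [TVertex (v, t)] = [TVertex (v, t)]"
    using w twalk_snoc_wait[OF w(1,3)] twalk_nonempty[OF w(1)] s assms branching_tverts[OF assms(2)]
    by (intro branching_walk_unique[of _ "(v, t)"]) (auto intro: twalk.single)
  then show False using twalk_nonempty[OF w(1)] by simp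
qed

text \<open>An arrival at a later time would compete with waiting. The two walks differ even for a
  loop with label \<open>(s, s + 1)\<close>, because only one of them records an edge before its
  last vertex.\<close>

lemma branching_edge:
  assumes "((u, t), (v, t')) \<in> tedges B"
  shows "((u, t), (v, t')) \<in> tedges G" "first_active G v t'"
proof -
  have sub: "temporal_subdigraph B G"
    using branching by (simp add: temporal_spanning_branching_def)
  show e: "((u, t), (v, t')) \<in> tedges G"
    using assms sub unfolding temporal_subdigraph_def tedges_def by blast
  then have tv: "(u, t) \<in> tverts G" "(v, t') \<in> tverts G"
    using G unfolding temporal_digraph_def tedges_def tverts_def by blast+
  show "first_active G v t'"
  proof (rule ccontr)
    assume "\<not> first_active G v t'"
    with tv(2) obtain s where s: "t' = s + 1" "(v, s) \<in> tverts G" by (rule predecessor_active)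
    obtain w where w: "twalk B w" "hd w \<in> TVertex ` R" "last w = TVertex (v, s)"
      using branching_walk[OF s(2)] .
    obtain w' where w': "twalk B w'" "hd w' \<in> TVertex ` R" "last w' = TVertex (u, t)"
      using branching_walk[OF tv(1)] .
    have "w @ [TVertex (v, t')] = w' @ [TEdge (u, t) (v, t'), TVertex (v, t')]"
      using w w' twalk_snoc_wait[OF w(1,3)] twalk_snoc_edge[OF w'(1,3) assms] s
        twalk_nonempty[OF w(1)] twalk_nonempty[OF w'(1)] branching_tverts[OF tv(2)] tv(2)
      by (intro branching_walk_unique[of _ "(v, t')"]) auto
    then have "w = w' @ [TEdge (u, t) (v, t')]" by simp
    then show False using w(3) by simp
  qed
qed

text \<open>Follow the walk from a root, which lies outside \<open>X\<close>, to a temporal vertex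
  over \<open>X\<close>.\<close>

lemma branching_enters:
  assumes "X \<subseteq> verts G" "X \<noteq> {}" "\<And>v t. (v, t) \<in> R \<Longrightarrow> v \<notin> X"
  obtains u t v t' where "((u, t), (v, t')) \<in> tedges B" "u \<notin> X" "v \<in> X"
proof -
  obtain v where v: "v \<in> X" "v \<in> verts G" using assms by blast
  obtain t where "first_active G v t" using first_active_exists[OF v(2)] by blast
  then have "(v, t) \<in> tverts G" using v by (auto simp: tverts_def first_active_def)
  then obtain w where w: "twalk B w" "hd w \<in> TVertex ` R" "last w = TVertex (v, t)"
    by (rule branching_walk)
  then obtain x where "hd w = TVertex x" "fst x \<notin> X" using assms(3) by auto
  then show thesis using twalk_crossing[OF w(1), of x X "(v, t)"] w(3) v(1) that by auto
qed

end

end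

section \<open>The reduction\<close>

text \<open>All entries of \<open>v\<close> are consulted because a repeated vertex has its times
  united. On instances satisfying the promise \<open>t\<close> comes from a temporal vertex, so
  being a lower bound means being the first active time.\<close>

definition is_first :: "tdigraph_rep \<Rightarrow> nat \<Rightarrow> nat \<Rightarrow> bool" where
  "is_first g v t \<longleftrightarrow> (\<forall>p\<in>set (fst g). fst p = v \<longrightarrow> (\<forall>s\<in>set (snd p). t \<le> s))"

definition first_edges :: "tdigraph_rep \<Rightarrow> ((nat \<times> nat) \<times> (nat \<times> nat)) list" where
  "first_edges g = filter (\<lambda>p. is_first g (snd (fst p)) (snd (snd p)))
     (concat (map (\<lambda>p. map (\<lambda>l. (fst p, l)) (snd p)) (snd g)))"

text \<open>Nodes of the flow network are lists of numbers: \<open>[v]\<close> is the vertex \<open>v\<close>, and the \<open>n\<close>-th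
  branching is represented by \<open>n + 2\<close> zeros.\<close>

definition vertex_nodes :: "tdigraph_rep \<Rightarrow> nat list list" where
  "vertex_nodes g = map (\<lambda>p. [fst p]) (fst g)"

definition arc_nodes :: "tdigraph_rep \<Rightarrow> (nat list \<times> nat list) list" where
  "arc_nodes g = map (\<lambda>p. ([fst (fst p)], [snd (fst p)])) (first_edges g)"

text \<open>Each name extends the previous one by a zero, so no arithmetic has to be shown
  polynomial. Counting starts at two zeros because \<open>[0]\<close> is the node of vertex
  0.\<close>

definition indexed :: "(nat \<times> nat) list list \<Rightarrow> (nat list \<times> (nat \<times> nat) list) list" where
  "indexed rs = rev (fold (\<lambda>r acc. (if acc \<noteq> [] then 0 # fst (hd acc) else [0, 0], r) # acc) rs [])"

definition index_nodes :: "(nat \<times> nat) list list \<Rightarrow> nat list list" where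
  "index_nodes rs = map fst (indexed rs)"

definition root_arcs :: "(nat \<times> nat) list list \<Rightarrow> (nat list \<times> nat list) list" where
  "root_arcs rs = concat (map (\<lambda>p. map (\<lambda>r. (fst p, [fst r])) (snd p)) (indexed rs))"

text \<open>Any label arriving at the first active time would do; the first one listed is
  taken.\<close>

definition label :: "tdigraph_rep \<Rightarrow> nat \<times> nat \<Rightarrow> nat \<times> nat" where
  "label g e = snd (hd (filter (\<lambda>p. fst p = e) (first_edges g)))"

definition branch :: "tdigraph_rep \<Rightarrow> (nat list \<times> nat list \<times> nat list) list \<Rightarrow> nat list \<Rightarrow> tdigraph_rep" where
  "branch g S i = (fst g, map (\<lambda>q. ((hd (fst (snd q)), hd (snd (snd q))),
     [label g (hd (fst (snd q)), hd (snd (snd q)))])) (filter (\<lambda>q. fst q = i) S))"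

definition packed :: "tdigraph_rep \<Rightarrow> (nat \<times> nat) list list \<Rightarrow> (nat list \<times> nat list \<times> nat list) list" where
  "packed g rs = pack (vertex_nodes g) (arc_nodes g) (index_nodes rs) (root_arcs rs)"

text \<open>The second test is \<open>full\<close> in executable form. If it fails, then by
  \<open>full_pack\<close> the cut condition is violated, and no branchings exist.\<close>

definition solve :: "tdigraph_rep \<times> (nat \<times> nat) list list \<Rightarrow> tdigraph_rep list option" where
  "solve x = (case x of (g, rs) \<Rightarrow>
     if (\<forall>r\<in>set rs. \<forall>y\<in>set r. is_first g (fst y) (snd y)) \<and>
       (\<forall>i\<in>set (index_nodes rs). \<forall>v\<in>set (vertex_nodes g).
          (i, v) \<in> set (covered (root_arcs rs) (packed g rs)))
     then Some (map (branch g (packed g rs)) (index_nodes rs)) else None)"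

definition index :: "nat \<Rightarrow> nat list" where
  "index n = replicate (n + 2) 0"

lemma index_eq_iff [simp]: "index m = index n \<longleftrightarrow> m = n"
  by (auto simp: index_def dest: arg_cong[where f = length])

lemma index_neq_vertex [simp]: "index n \<noteq> [v]" "[v] \<noteq> index n"
  by (auto simp: index_def)

lemma fold_indexed:
  "fold (\<lambda>r acc. (if acc \<noteq> [] then 0 # fst (hd acc) else [0, 0], r) # acc) rs [] =
    rev (map (\<lambda>n. (index n, rs ! n)) [0..<length rs])"
proof (induction rs rule: rev_induct)
  case (snoc r rs)
  have "map (\<lambda>n. (index n, (rs @ [r]) ! n)) [0..<length rs] = map (\<lambda>n. (index n, rs ! n)) [0..<length rs]"
    by (intro map_cong) (auto simp: nth_append)
  moreover have "(if rev (map (\<lambda>n. (index n, rs ! n)) [0..<length rs]) \<noteq> []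
      then 0 # fst (hd (rev (map (\<lambda>n. (index n, rs ! n)) [0..<length rs]))) else [0, 0]) = index (length rs)"
    by (cases "length rs") (auto simp: index_def)
  ultimately show ?case unfolding fold_append comp_apply snoc.IH by simp
qed simp

lemma indexed_eq: "indexed rs = map (\<lambda>n. (index n, rs ! n)) [0..<length rs]"
  unfolding indexed_def fold_indexed by simp

lemma index_nodes_eq: "index_nodes rs = map index [0..<length rs]"
  by (simp add: index_nodes_def indexed_eq)

lemma set_root_arcs: "set (root_arcs rs) = {(index n, [v]) | n v t. n < length rs \<and> (v, t) \<in> set (rs ! n)}"
  by (force simp: root_arcs_def indexed_eq)

subsection \<open>Running time\<close>

lemma polytime_indexed [polytime_intros]:
  assumes "polytime f"
  shows "polytime (\<lambda>x. indexed (f x))"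
proof -
  \<comment> \<open>There are at most \<open>size_of rs\<close> entries. Each consists of a name of
    size \<open>5 + 2 * n\<close>, a list from \<open>rs\<close> and one pair node, which accounts
    for the 6.\<close>
  let ?S = "\<lambda>rs :: (nat \<times> nat) list list. 1 + size_of rs * (1 + (2 * size_of rs + 6 + size_of rs))"
  have "polytime (\<lambda>rs. fold (\<lambda>r acc. (if acc \<noteq> [] then (0::nat) # fst (hd acc) else [0, 0], r) # acc)
      (rs :: (nat \<times> nat) list list) [])"
  proof (rule polytime_fold_prefix)
    show "poly_bounded ?S"
      by (intro poly_bounded_add poly_bounded_mult poly_bounded_const poly_bounded_size)
    fix rs ys zs :: "(nat \<times> nat) list list" assume eq: "rs = ys @ zs"
    have "size_of a \<le> 2 * size_of rs + 6 + size_of rs"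
      if a: "a \<in> set (rev (map (\<lambda>n. (index n, ys ! n)) [0..<length ys]))" for a
    proof -
      obtain n where n: "n < length ys" "a = (index n, ys ! n)" using a by auto
      have "size_of (0::nat) = 1" by (simp add: size_of_def enc_nat_inst enc_nat.simps)
      then have rep: "size_of (replicate m (0::nat)) = 1 + 2 * m" for m by (induction m) auto
      have "size_of (index n) = 5 + 2 * n" unfolding index_def rep by simp
      moreover have "size_of (ys ! n) \<le> size_of rs"
        using n(1) eq by (intro size_of_elem_le) auto
      moreover have "n < size_of rs" using n(1) length_le_size[of rs] eq by simp
      ultimately show ?thesis unfolding n(2) by simp
    qed
    moreover have "length (rev (map (\<lambda>n. (index n, ys ! n)) [0..<length ys])) \<le> size_of rs"
      using length_le_size[of rs] eq by simp
    ultimately show "size_of (fold (\<lambda>r acc. (if acc \<noteq> [] then (0::nat) # fst (hd acc) else [0, 0], r) # acc)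
        ys []) \<le> ?S rs"
      unfolding fold_indexed by (rule size_of_list_le)
  qed (intro polytime_intros)+
  then have "polytime indexed" unfolding indexed_def by (rule polytime_rev)
  then show ?thesis using assms by (rule polytime_comp)
qed

lemma polytime_index_nodes [polytime_intros]: "polytime f \<Longrightarrow> polytime (\<lambda>x. index_nodes (f x))"
  unfolding index_nodes_def by (intro polytime_intros)

lemma polytime_root_arcs [polytime_intros]: "polytime f \<Longrightarrow> polytime (\<lambda>x. root_arcs (f x))"
  unfolding root_arcs_def by (intro polytime_intros)

lemma polytime_is_first [polytime_intros]:
  assumes "polytime f" "polytime v" "polytime t"
  shows "polytime (\<lambda>x. is_first (f x) (v x) (t x))"
proof -
  have "polytime (\<lambda>p :: tdigraph_rep \<times> nat \<times> nat. is_first (fst p) (fst (snd p)) (snd (snd p)))"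
    unfolding is_first_def by (intro polytime_intros)
  from polytime_comp[OF this polytime_Pair[OF assms(1) polytime_Pair[OF assms(2,3)]]]
  show ?thesis by simp
qed

lemma polytime_first_edges [polytime_intros]:
  assumes "polytime f"
  shows "polytime (\<lambda>x. first_edges (f x))"
proof -
  have "polytime first_edges" unfolding first_edges_def by (intro polytime_intros)
  then show ?thesis using assms by (rule polytime_comp)
qed

lemma polytime_branch [polytime_intros]:
  assumes "polytime f" "polytime S" "polytime i"
  shows "polytime (\<lambda>x. branch (f x) (S x) (i x))"
proof -
  have "polytime (\<lambda>p. branch (fst p) (fst (snd p)) (snd (snd p)))"
    unfolding branch_def label_def by (intro polytime_intros)
  from polytime_comp[OF this polytime_Pair[OF assms(1) polytime_Pair[OF assms(2,3)]]]
  show ?thesis by simp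
qed

lemma polytime_solve: "polytime solve"
  unfolding solve_def packed_def covered_def vertex_nodes_def arc_nodes_def
  by (intro polytime_intros)

subsection \<open>Correctness\<close>

lemma active_tdigraph_of: "t \<in> active (tdigraph_of g) v \<longleftrightarrow> (\<exists>ts. (v, ts) \<in> set (fst g) \<and> t \<in> set ts)"
  by (auto simp: tdigraph_of_def)

lemma labels_tdigraph_of: "l \<in> labels (tdigraph_of g) e \<longleftrightarrow> (\<exists>ls. (e, ls) \<in> set (snd g) \<and> l \<in> set ls)"
  by (auto simp: tdigraph_of_def)

lemma verts_tdigraph_of: "verts (tdigraph_of g) = fst ` set (fst g)"
  by (simp add: tdigraph_of_def)

lemma edges_tdigraph_of: "edges (tdigraph_of g) = fst ` set (snd g)"
  by (simp add: tdigraph_of_def)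

lemma tedges_tdigraph_of:
  "((u, t), (v, t')) \<in> tedges (tdigraph_of g) \<longleftrightarrow> (\<exists>ls. ((u, v), ls) \<in> set (snd g) \<and> (t, t') \<in> set ls)"
  unfolding tedges_def by (force simp: labels_tdigraph_of edges_tdigraph_of)

lemma is_first_iff: "is_first g v t \<longleftrightarrow> (\<forall>s\<in>active (tdigraph_of g) v. t \<le> s)"
  unfolding is_first_def Ball_def active_tdigraph_of by auto

locale temporal_instance =
  fixes g :: tdigraph_rep and rs :: "(nat \<times> nat) list list"
  assumes digraph: "temporal_digraph (tdigraph_of g)"
    and intervals: "\<forall>v\<in>verts (tdigraph_of g). \<exists>a b. a \<le> b \<and> active (tdigraph_of g) v = {a..b}"
    and roots: "\<forall>r\<in>set rs. set r \<subseteq> tverts (tdigraph_of g)"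
begin

abbreviation "G \<equiv> tdigraph_of g"
abbreviation "V \<equiv> vertex_nodes g"
abbreviation "A \<equiv> arc_nodes g"
abbreviation "I \<equiv> index_nodes rs"
abbreviation "C \<equiv> root_arcs rs"
abbreviation "S \<equiv> packed g rs"

lemma tedge_tverts:
  assumes "((u, t), (v, t')) \<in> tedges G"
  shows "(u, t) \<in> tverts G" "(v, t') \<in> tverts G" "u \<in> verts G" "v \<in> verts G"
  using assms digraph unfolding temporal_digraph_def tedges_def tverts_def by blast+

lemma first_edges_iff:
  "((u, v), (t, t')) \<in> set (first_edges g) \<longleftrightarrow> ((u, t), (v, t')) \<in> tedges G \<and> first_active G v t'"
proof -
  have "((u, v), (t, t')) \<in> set (first_edges g) \<longleftrightarrow> ((u, t), (v, t')) \<in> tedges G \<and> is_first g v t'"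
    unfolding first_edges_def tedges_tdigraph_of by force
  then show ?thesis
    using tedge_tverts(2)[of u t v t'] by (auto simp: is_first_iff first_active_def tverts_def)
qed

lemma set_vertex_nodes: "set V = (\<lambda>v. [v]) ` verts G"
  by (auto simp: vertex_nodes_def verts_tdigraph_of)

text \<open>For an arc of the network the \<open>hd\<close> in \<open>label\<close> is taken of a
  nonempty list, so the chosen label is a genuine one.\<close>

lemma arc_nodesE:
  assumes "e \<in> set A"
  obtains u v where "e = ([u], [v])" "((u, v), label g (u, v)) \<in> set (first_edges g)"
proof -
  obtain u v l where e: "e = ([u], [v])" "((u, v), l) \<in> set (first_edges g)"
    using assms by (auto simp: arc_nodes_def)
  let ?F = "filter (\<lambda>p. fst p = (u, v)) (first_edges g)"
  have "?F \<noteq> []" using e(2) by (force simp: filter_empty_conv)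
  then have "hd ?F \<in> set ?F" by (rule hd_in_set)
  then have "fst (hd ?F) = (u, v)" "hd ?F \<in> set (first_edges g)" unfolding set_filter by blast+
  then have "((u, v), snd (hd ?F)) \<in> set (first_edges g)" by (metis prod.collapse)
  then show thesis using e that by (auto simp: label_def)
qed

lemma arc_nodesI: "((u, v), l) \<in> set (first_edges g) \<Longrightarrow> ([u], [v]) \<in> set A"
  by (force simp: arc_nodes_def)

sublocale interval_digraph G
  using digraph intervals by unfold_locales auto

sublocale packing V A I C
proof
  show "set A \<subseteq> set V \<times> set V"
  proof
    fix e assume "e \<in> set A"
    then obtain u v where "e = ([u], [v])" "((u, v), label g (u, v)) \<in> set (first_edges g)"
      by (rule arc_nodesE)
    then show "e \<in> set V \<times> set V"
      using first_edges_iff[of u v] tedge_tverts by (cases "label g (u, v)") (auto simp: set_vertex_nodes)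
  qed
  show "set C \<subseteq> set I \<times> set V"
  proof
    fix p assume "p \<in> set C"
    then obtain n v t where n: "p = (index n, [v])" "n < length rs" "(v, t) \<in> set (rs ! n)"
      by (auto simp: set_root_arcs)
    then have "(v, t) \<in> tverts G" using roots by (meson nth_mem subsetD)
    then show "p \<in> set I \<times> set V" using n by (auto simp: set_vertex_nodes index_nodes_eq tverts_def)
  qed
  show "set V \<inter> set I = {}" by (auto simp: set_vertex_nodes index_nodes_eq)
  show "distinct I" by (auto simp: index_nodes_eq distinct_map inj_on_def)
qed

lemma valid_packed: "valid S"
  unfolding packed_def by (rule valid_pack)

lemma packed_arcsE:
  assumes "(i, a, b) \<in> set S"
  obtains u v where "a = [u]" "b = [v]" "((u, v), label g (u, v)) \<in> set (first_edges g)"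
proof -
  have "(a, b) \<in> set A" using assms valid_packed by (auto simp: valid_def)
  then show thesis by (rule arc_nodesE) (use that in auto)
qed

section \<open>The branchings read off from the packing\<close>

abbreviation "B n \<equiv> tdigraph_of (branch g S (index n))"

lemma verts_branch: "verts (B n) = verts G"
  by (simp add: verts_tdigraph_of branch_def)

lemma active_branch: "active (B n) = active G"
  by (simp add: tdigraph_of_def branch_def)

text \<open>Decoding nodes by \<open>hd\<close> is reversible, since the arcs in \<open>S\<close>
  join singleton lists only.\<close>

lemma branch_entries:
  "((u, v), ls) \<in> set (snd (branch g S i)) \<longleftrightarrow> (i, [u], [v]) \<in> set S \<and> ls = [label g (u, v)]"
proof
  assume "((u, v), ls) \<in> set (snd (branch g S i))"
  then obtain a b where ab: "(i, a, b) \<in> set S" "u = hd a" "v = hd b" "ls = [label g (u, v)]"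
    by (auto simp: branch_def)
  then show "(i, [u], [v]) \<in> set S \<and> ls = [label g (u, v)]"
    by (metis list.sel(1) packed_arcsE)
next
  assume a: "(i, [u], [v]) \<in> set S \<and> ls = [label g (u, v)]"
  then have "(i, [u], [v]) \<in> set (filter (\<lambda>q. fst q = i) S)" by simp
  then show "((u, v), ls) \<in> set (snd (branch g S i))"
    using a unfolding branch_def snd_conv set_map by (intro image_eqI) auto
qed

lemma edges_branch: "(u, v) \<in> edges (B n) \<longleftrightarrow> (index n, [u], [v]) \<in> set S"
  unfolding edges_tdigraph_of using branch_entries[of u v _ "index n"] by force

lemma labels_branch: "l \<in> labels (B n) (u, v) \<longleftrightarrow> (index n, [u], [v]) \<in> set S \<and> l = label g (u, v)"
  unfolding labels_tdigraph_of using branch_entries[of u v _ "index n"] by auto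

lemma tedges_branch:
  "((u, t), (v, t')) \<in> tedges (B n) \<longleftrightarrow> (index n, [u], [v]) \<in> set S \<and> (t, t') = label g (u, v)"
  unfolding tedges_def by (auto simp: edges_branch labels_branch)

lemma tedges_branchD:
  assumes "((u, t), (v, t')) \<in> tedges (B n)"
  shows "((u, t), (v, t')) \<in> tedges G" "first_active G v t'"
proof -
  have S: "(index n, [u], [v]) \<in> set S" and l: "(t, t') = label g (u, v)"
    using assms by (auto simp: tedges_branch)
  from S have "((u, v), (t, t')) \<in> set (first_edges g)" unfolding l by (rule packed_arcsE) auto
  then show "((u, t), (v, t')) \<in> tedges G" "first_active G v t'" by (auto simp: first_edges_iff)
qed

lemma subdigraph_branch: "temporal_subdigraph (B n) G"
proof -
  have E: "((u, t), (v, t')) \<in> tedges G" if "(u, v) \<in> edges (B n)" "(t, t') \<in> labels (B n) (u, v)" for u v t t'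
    using that by (intro tedges_branchD(1)[of _ _ _ _ n]) (auto simp: tedges_def)
  have sub: "(u, v) \<in> edges G \<and> labels (B n) (u, v) \<subseteq> labels G (u, v)" if "(u, v) \<in> edges (B n)" for u v
  proof -
    have "label g (u, v) \<in> labels (B n) (u, v)" using that by (simp add: labels_branch edges_branch)
    then have "(u, v) \<in> edges G"
      using E[OF that, of "fst (label g (u, v))" "snd (label g (u, v))"] by (auto simp: tedges_def)
    moreover have "labels (B n) (u, v) \<subseteq> labels G (u, v)" using E[OF that] by (auto simp: tedges_def)
    ultimately show ?thesis by blast
  qed
  have "edges G \<subseteq> verts G \<times> verts G" using digraph by (simp add: temporal_digraph_def)
  then have "temporal_digraph (B n)"
    unfolding temporal_digraph_def verts_branch active_branch
    using digraph sub E tedge_tverts by (fastforce simp: temporal_digraph_def tverts_def)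
  then show ?thesis unfolding temporal_subdigraph_def verts_branch active_branch using sub by auto
qed

lemma spanning_branch:
  assumes first: "\<forall>r\<in>set rs. \<forall>y\<in>set r. is_first g (fst y) (snd y)" and "full S" and n: "n < length rs"
  shows "temporal_spanning_branching G (set (rs ! n)) (B n)"
proof -
  let ?R = "set (rs ! n)" and ?r = "{(u, v). (index n, [u], [v]) \<in> set S}"
  have nS: "rs ! n \<in> set rs" using n by simp
  have R: "first_active G v t" if "(v, t) \<in> ?R" for v t
  proof -
    have "is_first g v t" using first nS that by fastforce
    moreover have "(v, t) \<in> tverts G" using roots nS that by blast
    ultimately show ?thesis by (auto simp: first_active_def is_first_iff tverts_def)
  qed
  have "\<exists>!w. twalk (B n) w \<and> hd w \<in> TVertex ` ?R \<and> last w = TVertex (v, t)" if vt: "(v, t) \<in> tverts G" for v t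
  proof (rule unique_walks[where r = ?r])
    show "temporal_digraph (B n)" using subdigraph_branch by (simp add: temporal_subdigraph_def)
    show "tverts (B n) = tverts G" by (simp add: tverts_def verts_branch active_branch)
    show "first_active G v t" if "(v, t) \<in> ?R" for v t using that by (rule R)
    \<comment> \<open>Finite and acyclic on nodes, hence well-founded, and pulled back to vertices
      along \<open>\<lambda>v. [v]\<close>.\<close>
    show "wf ?r"
    proof -
      have "wf {e. (index n, e) \<in> set S}"
      proof (rule finite_acyclic_wf)
        show "finite {e. (index n, e) \<in> set S}"
          by (rule finite_subset[of _ "snd ` set S"]) force+
        show "acyclic {e. (index n, e) \<in> set S}" using valid_packed by (simp add: valid_def)
      qed
      then have "wf (inv_image {e. (index n, e) \<in> set S} (\<lambda>v. [v]))" by (rule wf_inv_image)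
      then show ?thesis by (rule wf_subset) (auto simp: inv_image_def)
    qed
    show "first_active G v t' \<and> (v, t') \<notin> ?R \<and> (u, v) \<in> ?r" if "((u, t), (v, t')) \<in> tedges (B n)" for u t v t'
    proof -
      have "(index n, [u], [v]) \<in> set S" using that by (simp add: tedges_branch)
      moreover from this have "(index n, [v]) \<notin> set C" using valid_packed by (simp add: valid_def)
      ultimately show ?thesis using tedges_branchD[OF that] n by (auto simp: set_root_arcs)
    qed
    show "x = x'" if "(x, y) \<in> tedges (B n)" "(x', y) \<in> tedges (B n)" for x x' y
    proof -
      obtain u t u' s v t' where xy: "x = (u, t)" "x' = (u', s)" "y = (v, t')" by (metis prod.exhaust)
      have "(index n, [u], [v]) \<in> set S" "(index n, [u'], [v]) \<in> set S"
        using that unfolding xy tedges_branch by auto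
      then have "[u] = [u']" using valid_packed unfolding valid_def by blast
      then show ?thesis using that unfolding xy tedges_branch by (metis Pair_inject list.inject)
    qed
    show "\<exists>x. (x, (v, t)) \<in> tedges (B n)"
      if "(v, t) \<in> tverts G" "first_active G v t" "(v, t) \<notin> ?R" for v t
    proof -
      have "(index n, [v]) \<in> set (covered C S)"
        using \<open>full S\<close> n that(1) unfolding full_def by (auto simp: set_vertex_nodes index_nodes_eq tverts_def)
      \<comment> \<open>A root at \<open>v\<close> would sit at the first active time, which is
        unique, so it would be \<open>(v, t)\<close> itself.\<close>
      moreover have "(index n, [v]) \<notin> set C"
        using that(2,3) R first_active_unique by (auto simp: set_root_arcs) blast
      ultimately obtain a where a: "(index n, a, [v]) \<in> set S" by (auto simp: set_covered)
      then obtain u where u: "a = [u]" "((u, v), label g (u, v)) \<in> set (first_edges g)"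
        by (rule packed_arcsE) auto
      obtain s t' where l: "label g (u, v) = (s, t')" by (cases "label g (u, v)")
      \<comment> \<open>The chosen label arrives at the first active time, hence at
        \<open>t\<close>; its departure time \<open>s\<close> may be arbitrary.\<close>
      have "first_active G v t'" using u(2) unfolding l by (simp add: first_edges_iff)
      then have "t' = t" using that(2) by (rule first_active_unique)
      then have "((u, s), (v, t)) \<in> tedges (B n)" using a u(1) l by (simp add: tedges_branch)
      then show ?thesis by blast
    qed
  qed (rule vt)
  then show ?thesis
    unfolding temporal_spanning_branching_def using subdigraph_branch by (metis surj_pair)
qed

lemma disjoint_branches:
  assumes "\<forall>r\<in>set rs. \<forall>y\<in>set r. is_first g (fst y) (snd y)" and "full S"
  shows "disjoint_spanning_branchings G (map set rs) (map tdigraph_of (map (branch g S) I))"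
proof -
  have "edge_disjoint (B m) (B n)" if "m \<noteq> n" for m n
  proof -
    have "(index m, e) \<notin> set S" if "(index n, e) \<in> set S" for e
      using valid_packed that \<open>m \<noteq> n\<close> unfolding valid_def by (metis index_eq_iff)
    then show ?thesis by (auto simp: edge_disjoint_def edges_branch)
  qed
  then show ?thesis
    using spanning_branch[OF assms] unfolding disjoint_spanning_branchings_def
    by (simp add: index_nodes_eq)
qed

section \<open>Disjoint branchings imply the cut condition\<close>

context
  fixes Bs
  assumes Bs: "disjoint_spanning_branchings G (map set rs) Bs"
begin

lemma nth_branching: "n < length rs \<Longrightarrow> temporal_spanning_branching G (set (rs ! n)) (Bs ! n)"
  using Bs by (simp add: disjoint_spanning_branchings_def)

lemma roots_first_if_branchings: "\<forall>r\<in>set rs. \<forall>y\<in>set r. is_first g (fst y) (snd y)"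
proof (intro ballI)
  fix r y assume r: "r \<in> set rs" "y \<in> set r"
  then obtain n where n: "n < length rs" "r = rs ! n" by (auto simp: in_set_conv_nth)
  have "y \<in> tverts G" using roots r by blast
  then have "first_active G (fst y) (snd y)"
    using branching_root_first[OF nth_branching[OF n(1)], of "fst y" "snd y"] r(2) n(2) by simp
  then show "is_first g (fst y) (snd y)" by (simp add: first_active_def is_first_iff)
qed

text \<open>A branching with no root in \<open>X\<close> has to enter \<open>X\<close>, at a first
  active time and hence along an arc of the network. Edge-disjointness makes these arcs distinct, so
  the missed indices inject into the arcs entering \<open>X\<close>.\<close>

lemma root_condition_if_branchings: "root_condition (set V) (set A) (set I) (\<lambda>i. set C `` {i})"
  unfolding root_condition_def
proof (intro allI impI)
  fix X assume X: "X \<subseteq> set V" "X \<noteq> {}"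
  define Y where "Y = {v. [v] \<in> X}"
  have Y: "Y \<subseteq> verts G" "Y \<noteq> {}" using X by (auto simp: Y_def set_vertex_nodes)
  let ?M = "missed (set I) (\<lambda>i. set C `` {i}) X"
  have "\<exists>e. e \<in> entering (set A) X \<and>
      (\<exists>n<length rs. i = index n \<and> (hd (fst e), hd (snd e)) \<in> edges (Bs ! n))" if i: "i \<in> ?M" for i
  proof -
    obtain n where n: "n < length rs" "i = index n"
      using i by (auto simp: missed_def index_nodes_eq)
    have "v \<notin> Y" if "(v, t) \<in> set (rs ! n)" for v t
    proof -
      have "(index n, [v]) \<in> set C" using that n(1) by (auto simp: set_root_arcs)
      then show ?thesis using i n(2) by (auto simp: missed_def Y_def)
    qed
    then obtain u t v t' where e: "((u, t), (v, t')) \<in> tedges (Bs ! n)" "u \<notin> Y" "v \<in> Y"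
      using branching_enters[OF nth_branching[OF n(1)] Y] by blast
    have "((u, v), (t, t')) \<in> set (first_edges g)"
      using branching_edge[OF nth_branching[OF n(1)] e(1)] by (simp add: first_edges_iff)
    then have "([u], [v]) \<in> entering (set A) X"
      using e(2,3) by (auto simp: entering_def Y_def dest: arc_nodesI)
    moreover have "(u, v) \<in> edges (Bs ! n)" using e(1) by (auto simp: tedges_def)
    ultimately show ?thesis using n by (intro exI[of _ "([u], [v])"]) auto
  qed
  then obtain f where f: "\<And>i. i \<in> ?M \<Longrightarrow> f i \<in> entering (set A) X \<and>
      (\<exists>n<length rs. i = index n \<and> (hd (fst (f i)), hd (snd (f i))) \<in> edges (Bs ! n))"
    by metis
  have "inj_on f ?M"
  proof (rule inj_onI)
    fix i j assume ij: "i \<in> ?M" "j \<in> ?M" "f i = f j"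
    obtain n m where nm: "n < length rs" "i = index n" "(hd (fst (f i)), hd (snd (f i))) \<in> edges (Bs ! n)"
      "m < length rs" "j = index m" "(hd (fst (f i)), hd (snd (f i))) \<in> edges (Bs ! m)"
      using f[OF ij(1)] f[OF ij(2)] ij(3) by auto
    then have "\<not> edge_disjoint (Bs ! n) (Bs ! m)" by (auto simp: edge_disjoint_def)
    then have "n = m" using Bs nm by (auto simp: disjoint_spanning_branchings_def)
    then show "i = j" using nm by simp
  qed
  then show "card ?M \<le> card (entering (set A) X)"
    using f by (intro card_inj_on_le[of f]) auto
qed

end

lemma solve_correct:
  "case solve (g, rs) of
     None \<Rightarrow> \<not> (\<exists>Bs. disjoint_spanning_branchings G (map set rs) Bs)
   | Some bs \<Rightarrow> disjoint_spanning_branchings G (map set rs) (map tdigraph_of bs)"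
proof -
  let ?first = "\<forall>r\<in>set rs. \<forall>y\<in>set r. is_first g (fst y) (snd y)"
  have solve: "solve (g, rs) = (if ?first \<and> full S then Some (map (branch g S) I) else None)"
    unfolding solve_def full_def by auto
  show ?thesis
  proof (cases "?first \<and> full S")
    case True
    then show ?thesis using disjoint_branches unfolding solve by simp
  next
    case False
    have "\<not> disjoint_spanning_branchings G (map set rs) Bs" for Bs
    proof
      assume Bs: "disjoint_spanning_branchings G (map set rs) Bs"
      have "full S"
        unfolding packed_def using root_condition_if_branchings[OF Bs] by (rule full_pack)
      then show False using False roots_first_if_branchings[OF Bs] by blast
    qed
    then show ?thesis using False unfolding solve by auto
  qed
qed

end

theorem theorem4:
  "solvable_in_polynomial_time
     (enc_pair enc_tdigraph enc_roots)
     (enc_option (enc_list enc_tdigraph))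
     (\<lambda>(g, rs).
        temporal_digraph (tdigraph_of g) \<and>
        (\<forall>v\<in>verts (tdigraph_of g). \<exists>a b. a \<le> b \<and> active (tdigraph_of g) v = {a..b}) \<and>
        (\<forall>r\<in>set rs. set r \<subseteq> tverts (tdigraph_of g)))
     (\<lambda>(g, rs) answer.
        case answer of
          None \<Rightarrow> \<not> (\<exists>Bs. disjoint_spanning_branchings (tdigraph_of g) (map set rs) Bs)
        | Some bs \<Rightarrow>
            disjoint_spanning_branchings (tdigraph_of g) (map set rs) (map tdigraph_of bs))"
proof -
  \<comment> \<open>The type class instances reproduce the encodings of the problem
    statement.\<close>
  have enc: "enc_tdigraph = enc" "enc_roots = enc"
    by (simp_all add: enc_tdigraph_def enc_roots_def enc_prod_inst enc_list_inst enc_nat_inst)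
  then have "enc_pair enc_tdigraph enc_roots = enc" "enc_option (enc_list enc_tdigraph) = enc"
    by (simp_all add: enc_prod_inst enc_list_inst enc_option_inst)
  moreover have "solvable_in_polynomial_time enc enc
     (\<lambda>(g, rs).
        temporal_digraph (tdigraph_of g) \<and>
        (\<forall>v\<in>verts (tdigraph_of g). \<exists>a b. a \<le> b \<and> active (tdigraph_of g) v = {a..b}) \<and>
        (\<forall>r\<in>set rs. set r \<subseteq> tverts (tdigraph_of g)))
     (\<lambda>(g, rs) answer.
        case answer of
          None \<Rightarrow> \<not> (\<exists>Bs. disjoint_spanning_branchings (tdigraph_of g) (map set rs) Bs)
        | Some bs \<Rightarrow>
            disjoint_spanning_branchings (tdigraph_of g) (map set rs) (map tdigraph_of bs))"
    (is "solvable_in_polynomial_time enc enc ?P ?Q")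
  proof (rule solvable_if_polytime[OF polytime_solve])
    fix x assume "?P x"
    obtain g rs where x: "x = (g, rs)" by (cases x)
    have "temporal_instance g rs" using \<open>?P x\<close> unfolding x temporal_instance_def prod.case .
    from temporal_instance.solve_correct[OF this] show "?Q x (solve x)" unfolding x prod.case .
  qed
  ultimately show ?thesis by simp
qed

end
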